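(* Let $A\in\mathbb{R}^{n\times n}$ be symmetric positive definite, $b\in\mathbb{R}^n$, $B\in\mathbb{R}^{p\times n}$ of full row rank, $c\in\mathbb{R}^p$. (i) Let $\mathcal F\subseteq\{1,\dots,n\}$ be such that $B_{\mathcal F}$ has full row rank $p$, and put $$v_0=A_{\mathcal F}^{-1}b_{\mathcal F},\quad V_1=A_{\mathcal F}^{-1}B_{\mathcal F}^\top,\quad S=B_{\mathcal F}V_1,\quad \lambda=S^{-1}(c-B_{\mathcal F}v_0),\quad \hat x_{\mathcal F}=v_0+V_1\lambda .$$ Let $\tilde v_0\in\mathbb{R}^{|\mathcal F|}$ and $\tilde V_1\in\mathbb{R}^{|\mathcal F|\times p}$ be approximations with residuals $$\rho_0=\|b_{\mathcal F}-A_{\mathcal F}\tilde v_0\|_2,\qquad \rho_1=\|B_{\mathcal F}^\top-A_{\mathcal F}\tilde V_1\|_2,$$ let $\tilde S=B_{\mathcal F}\tilde V_1$, $\tilde\lambda=\tilde S^{-1}(c-B_{\mathcal F}\tilde v_0)$, $\tilde x_{\mathcal F}=\tilde v_0+\tilde V_1\tilde\lambda$, and suppose $$\rho_1\,\|B_{\mathcal F}\|_2\le\tfrac12\,\lambda_{\min}(A)\,\lambda_{\min}(S).\qquad(\ast)$$ Then $$\delta_\lambda:=\|\tilde\lambda-\lambda\|_2\le\frac{2\|B_{\mathcal F}\|_2}{\lambda_{\min}(S)\lambda_{\min}(A)}\big(\rho_0+\rho_1\|\lambda\|_2\big),$$ $$\delta_x^{\mathrm{eq}}:=\|\tilde x_{\mathcal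 F}-\hat x_{\mathcal F}\|_2\le\frac{\rho_0+\rho_1\|\lambda\|_2}{\lambda_{\min}(A)}+\frac{\|B_{\mathcal F}\|_2+\rho_1}{\lambda_{\min}(A)}\,\delta_\lambda .$$ Moreover, extending $\hat x_{\mathcal F},\tilde x_{\mathcal F}$ by zeros to $\hat x,\tilde x\in\mathbb{R}^n$ and setting $\hat s=A\hat x-b-B^\top\lambda$, $\tilde s=A\tilde x-b-B^\top\tilde\lambda$, $$\delta_s^{\mathrm{eq}}:=\max_{i\notin\mathcal F}|\tilde s_i-\hat s_i|\le\lambda_{\max}(A)\,\delta_x^{\mathrm{eq}}+\|B\|_2\,\delta_\lambda .$$ (ii) Fix $p_{\max}\in\mathbb{N}$ and let $\mathcal F_0=\{1,\dots,n\},\mathcal F_1,\dots,\mathcal F_T$ be the sequence of free sets visited by the equality-augmented guarded active-set loop (defined in the context) run with exact inner solves, where $B_{\mathcal F_t}$ is assumed to have full row rank for all $t$ (so that the sequence is finite). Writing $\hat x(\mathcal F),\hat s(\mathcal F)$ for the exact vectors of (i), let $$\mu=\min_{0\le t\le T}\min\Big(\{|\hat x_i(\mathcal F_t)|: i\in\mathcal F_t,\ \hat x_i(\mathcal F_t)\neq0\}\cup\{|\hat s_i(\mathcal F_t)|: i\notin\mathcal F_t,\ \hat s_i(\mathcal F_t)\neq0\}\Big).$$ Consider the inexact equality-augmented loop with test tolerance $\varepsilon$, $0<\varepsilon<\mu$ (same $p_{\max}$, same initial free set), whose inner solves return $\tilde x,\tilde\lambda,\tilde s$ as in (i) with $(\ast)$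 satisfied. If at every outer step $\max(\delta_x^{\mathrm{eq}},\delta_s^{\mathrm{eq}})<\min(\varepsilon,\mu-\varepsilon)$, then the inexact loop visits exactly the free sets $\mathcal F_0,\dots,\mathcal F_T$ of the exact loop, in this order, and stops at step $T$; in particular it terminates after finitely many outer iterations, at the free set $\mathcal F_T$ on which the exact solve $\hat x(\mathcal F_T)$ is the unique global minimiser of $\tfrac12x^\top Ax-b^\top x$ subject to $Bx=c$, $x\ge0$.
   Context: $A_{\mathcal F}$ is the principal submatrix of $A$ indexed by $\mathcal F$, $b_{\mathcal F}$ the corresponding subvector, $B_{\mathcal F}$ the columns of $B$ in $\mathcal F$. For matrices $\|\cdot\|_2$ is the spectral norm; $\lambda_{\min},\lambda_{\max}$ denote extreme eigenvalues of symmetric matrices. The minimum of an empty set is $+\infty$; the maximum over an empty index set is $0$. Equality-augmented guarded active-set loop with patience budget $p_{\max}$ and test tolerance $\varepsilon\ge 0$. The state consists of a free set $\mathcal F$, a number $\bar N$ and a counter $q$, initialised as $\mathcal F=\{1,\dots,n\}$, $\bar N=n+1$, $q=p_{\max}$. Each outer iteration does the following. 1. Perform the inner solve on $\mathcal F$, obtaining $x\in\mathbb{R}^n$ (zero outside $\mathcal F$), a multiplier in $\mathbb{R}^p$, and the reduced gradient $s\in\mathbb{R}^n$: in the exact loop $(x,s)=(\hat x,\hat s)$, in the inexact loop $(x,s)=(\tilde x,\tilde s)$, with the notation of part (i) of the claim. 2. Form the violator sets $\mathcal D=\{i\in\mathcal F: x_i<-\varepsilon\}$ and $\mathcal V=\{i\notin\mathcal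 F: s_i<-\varepsilon\}$, and $N=|\mathcal D\cup\mathcal V|$. 3. If $N=0$, stop and return $x$. 4. Else if $N<\bar N$: set $\bar N\leftarrow N$, $q\leftarrow p_{\max}$, and $\mathcal F\leftarrow(\mathcal F\setminus\mathcal D)\cup\mathcal V$. 5. Else if $q>0$: set $q\leftarrow q-1$ and $\mathcal F\leftarrow(\mathcal F\setminus\mathcal D)\cup\mathcal V$. 6. Else: let $i^\star=\min(\mathcal D\cup\mathcal V)$; if $i^\star\in\mathcal D$ set $\mathcal F\leftarrow\mathcal F\setminus\{i^\star\}$, otherwise set $\mathcal F\leftarrow\mathcal F\cup\{i^\star\}$. The exact loop uses tolerance $0$ in step 2. It is known that if $B_{\mathcal F}$ has full row rank on every free set visited, the exact loop terminates after finitely many outer iterations and returns the unique global minimiser of $\tfrac12x^\top Ax-b^\top x$ subject to $Bx=c$, $x\ge 0$. *)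

theory Defs
  imports
    "Jordan_Normal_Form.Spectral_Radius"
    "Jordan_Normal_Form.Gauss_Jordan_Elimination"
    "Jordan_Normal_Form.DL_Rank"
    "Jordan_Normal_Form.DL_Submatrix"
    "HOL-Library.Extended_Real"
begin

text \<open>Indices are 0-based: the index set $\{1,\dots,n\}$ is rendered as \<open>{0..<n}\<close>, in the
  same order.\<close>

section \<open>Matrices and norms\<close>

definition vnorm :: "real vec \<Rightarrow> real" where
  "vnorm v = sqrt (v \<bullet> v)"

text \<open>The spectral norm, i.e. the operator norm induced by the Euclidean norm. The unit ball
  (rather than the sphere) makes it 0 for matrices without columns.\<close>

definition spectral_norm :: "real mat \<Rightarrow> real" where
  "spectral_norm M = Sup {vnorm (M *\<^sub>v v) | v. v \<in> carrier_vec (dim_col M) \<and> vnorm v \<le> 1}"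

text \<open>Extreme eigenvalues; used for symmetric matrices only, whose eigenvalues are all real.\<close>

definition lam_min :: "real mat \<Rightarrow> real" where
  "lam_min M = Min (spectrum M)"

definition lam_max :: "real mat \<Rightarrow> real" where
  "lam_max M = Max (spectrum M)"

definition sym_pos_def :: "nat \<Rightarrow> real mat \<Rightarrow> bool" where
  "sym_pos_def n A \<longleftrightarrow> A \<in> carrier_mat n n \<and> transpose_mat A = A \<and>
     (\<forall>v \<in> carrier_vec n. v \<noteq> 0\<^sub>v n \<longrightarrow> v \<bullet> (A *\<^sub>v v) > 0)"

definition full_row_rank :: "real mat \<Rightarrow> bool" where
  "full_row_rank M \<longleftrightarrow> vec_space.rank (dim_row M) M = dim_row M"

text \<open>The inverse of a matrix; unspecified if the matrix is not invertible.\<close>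

definition minv :: "real mat \<Rightarrow> real mat" where
  "minv M = the (mat_inverse M)"

definition subvec :: "real vec \<Rightarrow> nat set \<Rightarrow> real vec" where
  "subvec v F = vec (card {i. i < dim_vec v \<and> i \<in> F}) (\<lambda>k. v $ pick F k)"

abbreviation psub :: "real mat \<Rightarrow> nat set \<Rightarrow> real mat" where
  "psub A F \<equiv> submatrix A F F"

abbreviation csub :: "real mat \<Rightarrow> nat set \<Rightarrow> real mat" where
  "csub B F \<equiv> submatrix B UNIV F"

text \<open>Zero extension, the right inverse of \<^term>\<open>\<lambda>x. subvec x F\<close>: entry \<open>i \<in> F\<close> is
  stored at the position of \<open>i\<close> in the increasing enumeration \<^term>\<open>pick F\<close> of \<open>F\<close>.\<close>

definition zext :: "nat \<Rightarrow> nat set \<Rightarrow> real vec \<Rightarrow> real vec" where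
  "zext n F y = vec n (\<lambda>i. if i \<in> F then y $ card {j \<in> F. j < i} else 0)"

section \<open>Inner solves\<close>

definition v0_ex :: "real mat \<Rightarrow> real vec \<Rightarrow> nat set \<Rightarrow> real vec" where
  "v0_ex A b F = minv (psub A F) *\<^sub>v subvec b F"

definition V1_ex :: "real mat \<Rightarrow> real mat \<Rightarrow> nat set \<Rightarrow> real mat" where
  "V1_ex A B F = minv (psub A F) * transpose_mat (csub B F)"

definition schur :: "real mat \<Rightarrow> nat set \<Rightarrow> real mat \<Rightarrow> real mat" where
  "schur B F V1 = csub B F * V1"

definition multiplier :: "real mat \<Rightarrow> real vec \<Rightarrow> nat set \<Rightarrow> real vec \<Rightarrow> real mat \<Rightarrow> real vec" where
  "multiplier B c F v0 V1 = minv (schur B F V1) *\<^sub>v (c - csub B F *\<^sub>v v0)"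

definition xF :: "real mat \<Rightarrow> real vec \<Rightarrow> nat set \<Rightarrow> real vec \<Rightarrow> real mat \<Rightarrow> real vec" where
  "xF B c F v0 V1 = v0 + V1 *\<^sub>v multiplier B c F v0 V1"

definition xfull :: "nat \<Rightarrow> real mat \<Rightarrow> real vec \<Rightarrow> nat set \<Rightarrow> real vec \<Rightarrow> real mat \<Rightarrow> real vec" where
  "xfull n B c F v0 V1 = zext n F (xF B c F v0 V1)"

definition redgrad :: "real mat \<Rightarrow> real vec \<Rightarrow> real mat \<Rightarrow> real vec \<Rightarrow> nat set \<Rightarrow> real vec \<Rightarrow> real mat \<Rightarrow> real vec" where
  "redgrad A b B c F v0 V1 =
     A *\<^sub>v xfull (dim_row A) B c F v0 V1 - b - transpose_mat B *\<^sub>v multiplier B c F v0 V1"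

text \<open>The exact quantities: the same formulas evaluated at the exact $v_0$ and $V_1$.\<close>

definition S_ex :: "real mat \<Rightarrow> real mat \<Rightarrow> nat set \<Rightarrow> real mat" where
  "S_ex A B F = schur B F (V1_ex A B F)"

definition lam_ex :: "real mat \<Rightarrow> real vec \<Rightarrow> real mat \<Rightarrow> real vec \<Rightarrow> nat set \<Rightarrow> real vec" where
  "lam_ex A b B c F = multiplier B c F (v0_ex A b F) (V1_ex A B F)"

definition xF_ex :: "real mat \<Rightarrow> real vec \<Rightarrow> real mat \<Rightarrow> real vec \<Rightarrow> nat set \<Rightarrow> real vec" where
  "xF_ex A b B c F = xF B c F (v0_ex A b F) (V1_ex A B F)"

definition x_ex :: "real mat \<Rightarrow> real vec \<Rightarrow> real mat \<Rightarrow> real vec \<Rightarrow> nat set \<Rightarrow> real vec" where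
  "x_ex A b B c F = xfull (dim_row A) B c F (v0_ex A b F) (V1_ex A B F)"

definition s_ex :: "real mat \<Rightarrow> real vec \<Rightarrow> real mat \<Rightarrow> real vec \<Rightarrow> nat set \<Rightarrow> real vec" where
  "s_ex A b B c F = redgrad A b B c F (v0_ex A b F) (V1_ex A B F)"

section \<open>Residuals and errors\<close>

definition rho0 :: "real mat \<Rightarrow> real vec \<Rightarrow> nat set \<Rightarrow> real vec \<Rightarrow> real" where
  "rho0 A b F v0 = vnorm (subvec b F - psub A F *\<^sub>v v0)"

definition rho1 :: "real mat \<Rightarrow> real mat \<Rightarrow> nat set \<Rightarrow> real mat \<Rightarrow> real" where
  "rho1 A B F V1 = spectral_norm (transpose_mat (csub B F) - psub A F * V1)"

text \<open>Approximations of the right dimensions satisfying the residual condition $(\ast)$.\<close>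

definition admissible :: "real mat \<Rightarrow> real mat \<Rightarrow> nat set \<Rightarrow> real vec \<Rightarrow> real mat \<Rightarrow> bool" where
  "admissible A B F v0 V1 \<longleftrightarrow>
     v0 \<in> carrier_vec (card F) \<and> V1 \<in> carrier_mat (card F) (dim_row B) \<and>
     rho1 A B F V1 * spectral_norm (csub B F) \<le> 1 / 2 * lam_min A * lam_min (S_ex A B F)"

definition delta_lam :: "real mat \<Rightarrow> real vec \<Rightarrow> real mat \<Rightarrow> real vec \<Rightarrow> nat set \<Rightarrow> real vec \<Rightarrow> real mat \<Rightarrow> real" where
  "delta_lam A b B c F v0 V1 = vnorm (multiplier B c F v0 V1 - lam_ex A b B c F)"

definition delta_x :: "real mat \<Rightarrow> real vec \<Rightarrow> real mat \<Rightarrow> real vec \<Rightarrow> nat set \<Rightarrow> real vec \<Rightarrow> real mat \<Rightarrow> real" where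
  "delta_x A b B c F v0 V1 = vnorm (xF B c F v0 V1 - xF_ex A b B c F)"

text \<open>The inserted 0 is the value of the maximum over an empty index set; it is harmless
  otherwise, all other elements being nonnegative.\<close>

definition delta_s :: "real mat \<Rightarrow> real vec \<Rightarrow> real mat \<Rightarrow> real vec \<Rightarrow> nat set \<Rightarrow> real vec \<Rightarrow> real mat \<Rightarrow> real" where
  "delta_s A b B c F v0 V1 =
     Max (insert 0 {\<bar>redgrad A b B c F v0 V1 $ i - s_ex A b B c F $ i\<bar> | i. i < dim_row A \<and> i \<notin> F})"

section \<open>The guarded active-set loop\<close>

text \<open>States are triples of the free set $\mathcal F$, the number $\bar N$ and the counter $q$.\<close>

type_synonym loop_state = "nat set \<times> nat \<times> nat"

definition free_viol :: "real \<Rightarrow> nat set \<Rightarrow> real vec \<Rightarrow> nat set" where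
  "free_viol eps F x = {i \<in> F. x $ i < - eps}"

definition bound_viol :: "nat \<Rightarrow> real \<Rightarrow> nat set \<Rightarrow> real vec \<Rightarrow> nat set" where
  "bound_viol n eps F s = {i. i < n \<and> i \<notin> F \<and> s $ i < - eps}"

text \<open>One outer iteration with the result \<open>(x, s)\<close> of the inner solve; \<^term>\<open>None\<close> means that
  the loop stops.\<close>

definition loop_step :: "nat \<Rightarrow> nat \<Rightarrow> real \<Rightarrow> real vec \<times> real vec \<Rightarrow> loop_state \<Rightarrow> loop_state option" where
  "loop_step n pmax eps xs st =
    (let (x, s) = xs;
         (F, Nbar, q) = st;
         D = free_viol eps F x;
         V = bound_viol n eps F s;
         N = card (D \<union> V);
         i = Min (D \<union> V)
     in if N = 0 then None
        else if N < Nbar then Some ((F - D) \<union> V, N, pmax)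
        else if q > 0 then Some ((F - D) \<union> V, Nbar, q - 1)
        else if i \<in> D then Some (F - {i}, Nbar, q)
        else Some (F \<union> {i}, Nbar, q))"

text \<open>\<open>loop_at n pmax eps solve t\<close> is the state at the start of outer step \<open>t\<close>, or
  \<^term>\<open>None\<close> if the loop has stopped before. The inner solver may depend on the step, so that
  an inexact solver need not return the same result when a free set recurs.\<close>

primrec loop_at :: "nat \<Rightarrow> nat \<Rightarrow> real \<Rightarrow> (nat \<Rightarrow> nat set \<Rightarrow> real vec \<times> real vec) \<Rightarrow> nat \<Rightarrow> loop_state option" where
  "loop_at n pmax eps solve 0 = Some ({0..<n}, n + 1, pmax)"
| "loop_at n pmax eps solve (Suc t) =
     Option.bind (loop_at n pmax eps solve t) (\<lambda>st. loop_step n pmax eps (solve t (fst st)) st)"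

definition exact_visit :: "nat \<Rightarrow> real mat \<Rightarrow> real vec \<Rightarrow> real mat \<Rightarrow> real vec \<Rightarrow> nat \<Rightarrow> nat set option" where
  "exact_visit pmax A b B c t =
     map_option fst (loop_at (dim_row A) pmax 0 (\<lambda>_ F. (x_ex A b B c F, s_ex A b B c F)) t)"

text \<open>\<open>v0s t\<close> and \<open>V1s t\<close> are the approximations computed by the inner solve of step \<open>t\<close>.\<close>

definition inexact_visit :: "nat \<Rightarrow> real \<Rightarrow> real mat \<Rightarrow> real vec \<Rightarrow> real mat \<Rightarrow> real vec \<Rightarrow>
    (nat \<Rightarrow> real vec) \<Rightarrow> (nat \<Rightarrow> real mat) \<Rightarrow> nat \<Rightarrow> nat set option" where
  "inexact_visit pmax eps A b B c v0s V1s t =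
     map_option fst (loop_at (dim_row A) pmax eps
       (\<lambda>t F. (xfull (dim_row A) B c F (v0s t) (V1s t), redgrad A b B c F (v0s t) (V1s t))) t)"

text \<open>The loop visits exactly \<open>Fs 0, \<dots>, Fs T\<close>, in this order, and stops at step \<open>T\<close>.\<close>

definition visits_exactly :: "(nat \<Rightarrow> nat set option) \<Rightarrow> nat \<Rightarrow> (nat \<Rightarrow> nat set) \<Rightarrow> bool" where
  "visits_exactly visit T Fs \<longleftrightarrow> (\<forall>t\<le>T. visit t = Some (Fs t)) \<and> (\<forall>t>T. visit t = None)"

text \<open>Extended reals, because the set of nonzero entries may be empty, in which case the minimum
  is $+\infty$. All infima are over finite sets.\<close>

definition sep :: "real mat \<Rightarrow> real vec \<Rightarrow> real mat \<Rightarrow> real vec \<Rightarrow> nat \<Rightarrow> (nat \<Rightarrow> nat set) \<Rightarrow> ereal" where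
  "sep A b B c T Fs = (INF t\<in>{0..T}. Inf
     ({ereal \<bar>x_ex A b B c (Fs t) $ i\<bar> | i. i \<in> Fs t \<and> x_ex A b B c (Fs t) $ i \<noteq> 0} \<union>
      {ereal \<bar>s_ex A b B c (Fs t) $ i\<bar> | i. i < dim_row A \<and> i \<notin> Fs t \<and> s_ex A b B c (Fs t) $ i \<noteq> 0}))"

section \<open>The quadratic program\<close>

definition feasible :: "nat \<Rightarrow> real mat \<Rightarrow> real vec \<Rightarrow> real vec \<Rightarrow> bool" where
  "feasible n B c x \<longleftrightarrow> x \<in> carrier_vec n \<and> B *\<^sub>v x = c \<and> (\<forall>i<n. x $ i \<ge> 0)"

definition objective :: "real mat \<Rightarrow> real vec \<Rightarrow> real vec \<Rightarrow> real" where
  "objective A b x = 1 / 2 * (x \<bullet> (A *\<^sub>v x)) - b \<bullet> x"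

definition unique_minimiser :: "real mat \<Rightarrow> real vec \<Rightarrow> real mat \<Rightarrow> real vec \<Rightarrow> real vec \<Rightarrow> bool" where
  "unique_minimiser A b B c x \<longleftrightarrow>
     is_arg_min (objective A b) (feasible (dim_row A) B c) x \<and>
     (\<forall>y. is_arg_min (objective A b) (feasible (dim_row A) B c) y \<longrightarrow> y = x)"

end

theory Submission
  imports Defs "HOL-Analysis.L2_Norm"
begin

text \<open>
The error bounds rest on coercivity. The restricted matrix \<open>A\<^sub>F\<close> has the form of \<open>A\<close> on zero
extensions, so that \<open>\<lambda>\<^sub>m\<^sub>i\<^sub>n(A) |v| \<le> |A\<^sub>F v|\<close>, and a residual of an inner linear solve turns into an
error by division by \<open>\<lambda>\<^sub>m\<^sub>i\<^sub>n(A)\<close>. The error of \<open>V\<^sub>1\<close> perturbs the Schur complement by at most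
\<open>\<rho>\<^sub>1 |B\<^sub>F| / \<lambda>\<^sub>m\<^sub>i\<^sub>n(A)\<close>. By the residual condition this is at most half of \<open>\<lambda>\<^sub>m\<^sub>i\<^sub>n(S)\<close>, so that the
perturbed Schur complement is still invertible, with half of the lower bound
(\<open>schur_coercive\<close>); this is the source of the factor 2. The three bounds follow by splitting the
errors (\<open>multiplier_error_le\<close>, \<open>x_error_le\<close>, \<open>s_error_le\<close>). The extreme eigenvalues
are tied to the quadratic form by a proof that the infimum of the Rayleigh quotient of a symmetric
matrix is an eigenvalue (\<open>Rayleigh_infimum_eigenvalue\<close>).

The exact loop terminates because the pair of the least number of violations so far and the
remaining budget cannot decrease forever: an infinite run would eventually consist of single pivots on the least
violated index, as in Murty's method for linear complementarity problems. Take the greatest index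
\<open>K\<close> that is pivoted infinitely often and two consecutive pivots on it. Between them, only smaller
indices move. At both, \<open>K\<close> is violated, once as a free and once as a bound index, and all smaller
indices are in order. This makes \<open>(x - x') \<bullet> (s - s')\<close> negative
(\<open>no_infinite_least_index_pivoting\<close>), whereas \<open>B x = B x'\<close> reduces it to the form of \<open>A\<close> at \<open>x - x'\<close>
(\<open>exact_solves_monotone\<close>). When the loop stops, the Karush-Kuhn-Tucker conditions hold, and
they are sufficient for strictly convex programs (\<open>exact_solve_unique_minimiser\<close>).

Finally, the exact entries tested for violation are zero or at least \<open>\<mu>\<close> in absolute value. An
error below \<open>\<epsilon>\<close> and \<open>\<mu> - \<epsilon>\<close> cannot change the outcome of any test, hence the inexact loop goes
through the same states as the exact one (\<open>inexact_loop_eq_exact_loop\<close>).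
\<close>

section \<open>The Euclidean norm\<close>

lemma vnorm_L2_set: "vnorm v = L2_set (vec_index v) {0..<dim_vec v}"
  by (simp add: vnorm_def L2_set_def scalar_prod_def power2_eq_square)

lemma vnorm_nonneg [simp]: "0 \<le> vnorm v"
  by (simp add: vnorm_L2_set)

lemma scalar_prod_self_nonneg: "0 \<le> v \<bullet> v" for v :: "real vec"
  by (auto simp: scalar_prod_def intro!: sum_nonneg)

lemma vnorm_sq: "(vnorm v)\<^sup>2 = v \<bullet> v"
  by (simp add: vnorm_def scalar_prod_self_nonneg)

lemma vnorm_triangle:
  "\<lbrakk>u \<in> carrier_vec n; v \<in> carrier_vec n\<rbrakk> \<Longrightarrow> vnorm (u + v) \<le> vnorm u + vnorm v"
proof -
  assume uv: "u \<in> carrier_vec n" "v \<in> carrier_vec n"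
  have "L2_set (vec_index (u + v)) {0..<n} = L2_set (\<lambda>i. u $ i + v $ i) {0..<n}"
    using uv by (intro L2_set_cong) auto
  then show ?thesis
    using L2_set_triangle_ineq[of "vec_index u" "vec_index v" "{0..<n}"] uv
    by (simp add: vnorm_L2_set)
qed

lemma vnorm_uminus: "vnorm (- v) = vnorm v"
  by (simp add: vnorm_def)

lemma vnorm_minus_commute:
  "\<lbrakk>u \<in> carrier_vec n; v \<in> carrier_vec n\<rbrakk> \<Longrightarrow> vnorm (u - v) = vnorm (v - u)"
proof -
  assume "u \<in> carrier_vec n" "v \<in> carrier_vec n"
  then have "u - v = - (v - u)" by (intro eq_vecI) auto
  then show ?thesis by (simp only: vnorm_uminus)
qed

lemma vnorm_smult: "vnorm (a \<cdot>\<^sub>v v) = \<bar>a\<bar> * vnorm v"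
  by (simp add: vnorm_def real_sqrt_mult flip: mult.assoc)

lemma Cauchy_Schwarz_vnorm:
  assumes "u \<in> carrier_vec n" "v \<in> carrier_vec n"
  shows "\<bar>u \<bullet> v\<bar> \<le> vnorm u * vnorm v"
proof -
  have "\<bar>u \<bullet> v\<bar> \<le> (\<Sum>i\<in>{0..<n}. \<bar>u $ i\<bar> * \<bar>v $ i\<bar>)"
    using assms by (auto simp: scalar_prod_def abs_mult intro!: order_trans[OF sum_abs])
  also have "\<dots> \<le> vnorm u * vnorm v"
    using L2_set_mult_ineq[of "vec_index u" "vec_index v" "{0..<n}"] assms
    by (simp add: vnorm_L2_set)
  finally show ?thesis .
qed

lemma vnorm_le_sum_abs: "vnorm v \<le> (\<Sum>i\<in>{0..<dim_vec v}. \<bar>v $ i\<bar>)"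
  by (simp add: vnorm_L2_set L2_set_le_sum_abs)

lemma abs_index_le_vnorm: "i < dim_vec v \<Longrightarrow> \<bar>v $ i\<bar> \<le> vnorm v"
  using member_le_L2_set[of "{0..<dim_vec v}" i "\<lambda>i. \<bar>v $ i\<bar>"]
  by (simp add: vnorm_L2_set L2_set_def)

lemma vnorm_zero [simp]: "vnorm (0\<^sub>v n) = 0"
  by (simp add: vnorm_def)

lemma vnorm_dim_0: "v \<in> carrier_vec 0 \<Longrightarrow> vnorm v = 0"
  by (simp add: vnorm_def scalar_prod_def)

lemma vnorm_eq_0D: "\<lbrakk>v \<in> carrier_vec n; vnorm v = 0\<rbrakk> \<Longrightarrow> v = 0\<^sub>v n"
  using abs_index_le_vnorm[of _ v] by (intro eq_vecI) fastforce+

section \<open>The spectral norm\<close>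

lemma vnorm_mult_mat_vec_bounded:
  assumes "M \<in> carrier_mat nr nc"
  obtains K where "0 \<le> K" "\<And>v. v \<in> carrier_vec nc \<Longrightarrow> vnorm (M *\<^sub>v v) \<le> K * vnorm v"
proof
  let ?K = "\<Sum>i\<in>{0..<nr}. vnorm (row M i)"
  show "0 \<le> ?K" by (simp add: sum_nonneg)
  fix v :: "real vec" assume v: "v \<in> carrier_vec nc"
  have "vnorm (M *\<^sub>v v) \<le> (\<Sum>i\<in>{0..<nr}. \<bar>row M i \<bullet> v\<bar>)"
    using vnorm_le_sum_abs[of "M *\<^sub>v v"] assms by simp
  also have "\<dots> \<le> (\<Sum>i\<in>{0..<nr}. vnorm (row M i) * vnorm v)"
    using assms v by (intro sum_mono Cauchy_Schwarz_vnorm[of _ nc]) auto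
  finally show "vnorm (M *\<^sub>v v) \<le> ?K * vnorm v" by (simp add: sum_distrib_right)
qed

lemma spectral_norm_bdd:
  "bdd_above {vnorm (M *\<^sub>v v) | v. v \<in> carrier_vec (dim_col M) \<and> vnorm v \<le> 1}"
proof -
  obtain K where K: "0 \<le> K" "\<And>v. v \<in> carrier_vec (dim_col M) \<Longrightarrow> vnorm (M *\<^sub>v v) \<le> K * vnorm v"
    using vnorm_mult_mat_vec_bounded[of M "dim_row M" "dim_col M"] by blast
  show ?thesis
  proof (rule bdd_aboveI[of _ K], clarify)
    fix v assume "v \<in> carrier_vec (dim_col M)" "vnorm v \<le> 1"
    then show "vnorm (M *\<^sub>v v) \<le> K"
      using K(2)[of v] mult_left_le[of "vnorm v" K] K(1) by linarith
  qed
qed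

lemma spectral_norm_leI:
  assumes "\<And>v. \<lbrakk>v \<in> carrier_vec (dim_col M); vnorm v \<le> 1\<rbrakk> \<Longrightarrow> vnorm (M *\<^sub>v v) \<le> K"
  shows "spectral_norm M \<le> K"
  unfolding spectral_norm_def
proof (rule cSup_least)
  have "vnorm (M *\<^sub>v 0\<^sub>v (dim_col M)) \<in>
      {vnorm (M *\<^sub>v v) | v. v \<in> carrier_vec (dim_col M) \<and> vnorm v \<le> 1}"
    by force
  then show "{vnorm (M *\<^sub>v v) | v. v \<in> carrier_vec (dim_col M) \<and> vnorm v \<le> 1} \<noteq> {}"
    by blast
qed (use assms in blast)

lemma spectral_norm_ge:
  "\<lbrakk>v \<in> carrier_vec (dim_col M); vnorm v \<le> 1\<rbrakk> \<Longrightarrow> vnorm (M *\<^sub>v v) \<le> spectral_norm M"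
  unfolding spectral_norm_def by (rule cSup_upper[OF _ spectral_norm_bdd]) blast

lemma spectral_norm_nonneg: "0 \<le> spectral_norm M"
  using spectral_norm_ge[of "0\<^sub>v (dim_col M)" M] order_trans[OF vnorm_nonneg] by force

lemma vnorm_mult_mat_vec_le:
  assumes "M \<in> carrier_mat nr nc" "v \<in> carrier_vec nc"
  shows "vnorm (M *\<^sub>v v) \<le> spectral_norm M * vnorm v"
proof (cases "vnorm v = 0")
  case True
  obtain K where "vnorm (M *\<^sub>v v) \<le> K * vnorm v"
    using vnorm_mult_mat_vec_bounded[OF assms(1)] assms(2) by metis
  with True show ?thesis by simp
next
  case False
  let ?a = "1 / vnorm v"
  have "M *\<^sub>v (?a \<cdot>\<^sub>v v) = ?a \<cdot>\<^sub>v (M *\<^sub>v v)"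
    using assms by (simp add: mult_mat_vec)
  then have "\<bar>?a\<bar> * vnorm (M *\<^sub>v v) \<le> spectral_norm M"
    using spectral_norm_ge[of "?a \<cdot>\<^sub>v v" M] assms False by (simp add: vnorm_smult)
  moreover have "0 < vnorm v" using False vnorm_nonneg[of v] by linarith
  ultimately show ?thesis by (simp add: field_simps)
qed

text \<open>This follows from the Cauchy-Schwarz inequality for \<open>w\<close> and \<open>M M\<^sup>T w\<close>, whose scalar product is
  the square of the norm on the left.\<close>

lemma vnorm_mult_transpose_le:
  assumes M: "M \<in> carrier_mat nr nc" and w: "w \<in> carrier_vec nr"
  shows "vnorm (transpose_mat M *\<^sub>v w) \<le> spectral_norm M * vnorm w"
proof -
  let ?u = "transpose_mat M *\<^sub>v w"
  have u: "?u \<in> carrier_vec nc" using M w by auto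
  have "(vnorm ?u)\<^sup>2 = w \<bullet> (M *\<^sub>v ?u)"
    using transpose_vec_mult_scalar[OF M u w] by (simp add: vnorm_sq)
  also have "\<dots> \<le> vnorm w * (spectral_norm M * vnorm ?u)"
    using Cauchy_Schwarz_vnorm[of w nr "M *\<^sub>v ?u"] vnorm_mult_mat_vec_le[OF M u] M w u
      mult_left_mono[OF vnorm_mult_mat_vec_le[OF M u] vnorm_nonneg[of w]]
    by fastforce
  finally have *: "vnorm ?u * vnorm ?u \<le> (spectral_norm M * vnorm w) * vnorm ?u"
    by (simp add: power2_eq_square mult_ac)
  show ?thesis
  proof (cases "vnorm ?u = 0")
    case True
    then show ?thesis by (simp add: spectral_norm_nonneg)
  next
    case False
    then have "0 < vnorm ?u" using vnorm_nonneg[of ?u] by linarith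
    then show ?thesis using * by simp
  qed
qed

section \<open>Extreme eigenvalues of symmetric matrices\<close>

text \<open>The discriminant of a quadratic polynomial without sign change, including the degenerate
  leading coefficient 0.\<close>

lemma square_le_of_quadratic_nonneg:
  fixes a b c :: real
  assumes "\<And>t. 0 \<le> a + 2 * b * t + c * t\<^sup>2"
  shows "b\<^sup>2 \<le> a * c"
proof (cases "c = 0")
  case True
  have "b = 0"
  proof (rule ccontr)
    assume "b \<noteq> 0"
    with assms[of "- (a + 1) / (2 * b)"] True show False by simp
  qed
  with True show ?thesis by simp
next
  case False
  have a: "0 \<le> a" using assms[of 0] by simp
  have "0 < c"
  proof (rule ccontr)
    assume "\<not> 0 < c"
    with False have c: "c < 0" by simp
    define t where "t = sqrt ((a + 1) / (- c))"
    have "t\<^sup>2 = (a + 1) / (- c)" using a c by (simp add: t_def divide_nonneg_neg)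
    then have "c * t\<^sup>2 = - (a + 1)" using c by (simp add: field_simps)
    moreover have "0 \<le> a + c * t\<^sup>2" using assms[of t] assms[of "- t"] by simp
    ultimately show False by simp
  qed
  moreover have "0 \<le> a + 2 * b * (- b / c) + c * (- b / c)\<^sup>2" by (rule assms)
  ultimately show ?thesis by (simp add: field_simps power2_eq_square)
qed

text \<open>How lower bounds on a quadratic form become lower bounds on images: take \<open>w\<close> to be the image
  of \<open>v\<close>.\<close>

lemma vnorm_geI:
  assumes vw: "v \<in> carrier_vec k" "w \<in> carrier_vec k" and le: "a * (v \<bullet> v) \<le> v \<bullet> w"
  shows "a * vnorm v \<le> vnorm w"
proof (cases "vnorm v = 0")
  case False
  then have pos: "0 < vnorm v" using vnorm_nonneg[of v] by linarith
  have "(a * vnorm v) * vnorm v \<le> v \<bullet> w"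
    using le by (simp add: power2_eq_square mult.assoc flip: vnorm_sq)
  also have "\<dots> \<le> vnorm w * vnorm v"
    using Cauchy_Schwarz_vnorm[OF vw] by (simp add: mult.commute)
  finally show ?thesis using pos by simp
qed simp

locale symmetric_mat =
  fixes k :: nat and M :: "real mat"
  assumes M_carrier [simp]: "M \<in> carrier_mat k k"
    and M_symmetric: "transpose_mat M = M"
begin

lemma dim_M [simp]: "dim_row M = k" "dim_col M = k"
  using carrier_matD[OF M_carrier] by auto

lemma mult_M_carrier [simp]: "v \<in> carrier_vec k \<Longrightarrow> M *\<^sub>v v \<in> carrier_vec k"
  by (rule mult_mat_vec_carrier[OF M_carrier])

lemma form_commute:
  assumes "u \<in> carrier_vec k" "v \<in> carrier_vec k"
  shows "u \<bullet> (M *\<^sub>v v) = v \<bullet> (M *\<^sub>v u)"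
  using transpose_vec_mult_scalar[OF M_carrier assms(2,1)] assms
    comm_scalar_prod[of v k "M *\<^sub>v u"] by (simp add: M_symmetric)

lemma form_add_smult:
  assumes u: "u \<in> carrier_vec k" and v: "v \<in> carrier_vec k"
  shows "(u + t \<cdot>\<^sub>v v) \<bullet> (M *\<^sub>v (u + t \<cdot>\<^sub>v v)) =
    u \<bullet> (M *\<^sub>v u) + 2 * (u \<bullet> (M *\<^sub>v v)) * t + (v \<bullet> (M *\<^sub>v v)) * t\<^sup>2"
proof -
  have tv: "t \<cdot>\<^sub>v v \<in> carrier_vec k" using v by simp
  have Mtv: "M *\<^sub>v (t \<cdot>\<^sub>v v) = t \<cdot>\<^sub>v (M *\<^sub>v v)" using mult_mat_vec[OF M_carrier v] .
  have "M *\<^sub>v (u + t \<cdot>\<^sub>v v) = M *\<^sub>v u + t \<cdot>\<^sub>v (M *\<^sub>v v)"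
    using mult_add_distrib_mat_vec[OF M_carrier u tv] by (simp only: Mtv)
  moreover have c: "M *\<^sub>v u \<in> carrier_vec k" "t \<cdot>\<^sub>v (M *\<^sub>v v) \<in> carrier_vec k"
    "M *\<^sub>v v \<in> carrier_vec k" "M *\<^sub>v u + t \<cdot>\<^sub>v (M *\<^sub>v v) \<in> carrier_vec k"
    using u v by simp_all
  ultimately have "(u + t \<cdot>\<^sub>v v) \<bullet> (M *\<^sub>v (u + t \<cdot>\<^sub>v v)) =
    u \<bullet> (M *\<^sub>v u) + t * (u \<bullet> (M *\<^sub>v v)) + (t * (v \<bullet> (M *\<^sub>v u)) + t * (t * (v \<bullet> (M *\<^sub>v v))))"
    by (simp only: add_scalar_prod_distrib[OF u tv c(4)] scalar_prod_add_distrib[OF u c(1,2)]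
        scalar_prod_add_distrib[OF tv c(1,2)] scalar_prod_smult_distrib[OF u c(3)]
        smult_scalar_prod_distrib[OF v c(1)] smult_scalar_prod_distrib[OF v c(2)]
        scalar_prod_smult_distrib[OF v c(3)])
  then show ?thesis
    using form_commute[OF u v] by (simp add: algebra_simps power2_eq_square)
qed

lemma form_Cauchy_Schwarz:
  assumes psd: "\<And>w. w \<in> carrier_vec k \<Longrightarrow> 0 \<le> w \<bullet> (M *\<^sub>v w)"
    and u: "u \<in> carrier_vec k" and v: "v \<in> carrier_vec k"
  shows "(u \<bullet> (M *\<^sub>v v))\<^sup>2 \<le> (u \<bullet> (M *\<^sub>v u)) * (v \<bullet> (M *\<^sub>v v))"
proof (rule square_le_of_quadratic_nonneg)
  fix t :: real
  show "0 \<le> u \<bullet> (M *\<^sub>v u) + 2 * (u \<bullet> (M *\<^sub>v v)) * t + (v \<bullet> (M *\<^sub>v v)) * t\<^sup>2"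
    using psd[of "u + t \<cdot>\<^sub>v v"] u v by (simp only: form_add_smult[OF u v]) simp
qed

text \<open>Apply the Cauchy-Schwarz inequality of the form to \<open>M v\<close> and \<open>v\<close>. Both upper bounds on the
  norm of the image and, for invertible matrices, lower bounds on the form come from this.\<close>

lemma vnorm_mult_sq_le_form:
  assumes psd: "\<And>w. w \<in> carrier_vec k \<Longrightarrow> 0 \<le> w \<bullet> (M *\<^sub>v w)"
    and K: "0 \<le> K" "\<And>w. w \<in> carrier_vec k \<Longrightarrow> w \<bullet> (M *\<^sub>v w) \<le> K * (w \<bullet> w)"
    and v: "v \<in> carrier_vec k"
  shows "(vnorm (M *\<^sub>v v))\<^sup>2 \<le> K * (v \<bullet> (M *\<^sub>v v))"
proof -
  let ?w = "M *\<^sub>v v"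
  have w: "?w \<in> carrier_vec k" using v by simp
  have "(?w \<bullet> ?w)\<^sup>2 \<le> (?w \<bullet> (M *\<^sub>v ?w)) * (v \<bullet> ?w)"
    using form_Cauchy_Schwarz[OF psd w v] .
  also have "\<dots> \<le> (K * (?w \<bullet> ?w)) * (v \<bullet> ?w)"
    by (intro mult_right_mono K(2) psd w v)
  finally have *: "(?w \<bullet> ?w) * (?w \<bullet> ?w) \<le> (K * (v \<bullet> ?w)) * (?w \<bullet> ?w)"
    by (simp add: power2_eq_square mult_ac)
  show ?thesis
  proof (cases "?w \<bullet> ?w = 0")
    case True
    then show ?thesis using K(1) psd[OF v] by (simp add: vnorm_sq)
  next
    case False
    then have "0 < ?w \<bullet> ?w" using scalar_prod_self_nonneg[of ?w] by linarith
    then show ?thesis using * by (simp add: vnorm_sq)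
  qed
qed

end

lemma injective_square_mat_has_inverse:
  fixes M :: "'a :: field mat"
  assumes M: "M \<in> carrier_mat k k"
    and inj: "\<And>v. \<lbrakk>v \<in> carrier_vec k; M *\<^sub>v v = 0\<^sub>v k\<rbrakk> \<Longrightarrow> v = 0\<^sub>v k"
  obtains N where "mat_inverse M = Some N" "M * N = 1\<^sub>m k" "N * M = 1\<^sub>m k" "N \<in> carrier_mat k k"
proof -
  have "det M \<noteq> 0"
    using det_0_iff_vec_prod_zero_field[OF M] inj by blast
  then have "M \<in> Units (ring_mat TYPE('a) k ())"
    by (rule det_non_zero_imp_unit[OF M])
  then obtain N where N: "mat_inverse M = Some N"
    using mat_inverse(1)[OF M, of "()"] by (cases "mat_inverse M") auto
  with mat_inverse(2)[OF M N] that show thesis by blast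
qed

context symmetric_mat
begin

text \<open>If the infimum of the Rayleigh quotient were not an eigenvalue, \<open>M\<close> shifted by it would be
  semidefinite and invertible. Both together bound its form from below by a positive multiple of
  the square of the norm, so that the Rayleigh quotient would stay above its infimum by a fixed
  amount.\<close>

lemma Rayleigh_infimum_eigenvalue:
  assumes k: "0 < k"
  obtains \<mu> where "eigenvalue M \<mu>" "\<And>v. v \<in> carrier_vec k \<Longrightarrow> \<mu> * (v \<bullet> v) \<le> v \<bullet> (M *\<^sub>v v)"
proof -
  define R where "R = (\<lambda>v. v \<bullet> (M *\<^sub>v v) / (v \<bullet> v)) ` {v \<in> carrier_vec k. v \<noteq> 0\<^sub>v k}"
  have pos: "0 < v \<bullet> v" if "v \<in> carrier_vec k" "v \<noteq> 0\<^sub>v k" for v :: "real vec"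
    using scalar_prod_self_nonneg[of v] vnorm_eq_0D[of v k] vnorm_sq[of v] that by fastforce
  obtain K where K: "0 \<le> K" "\<And>v. v \<in> carrier_vec k \<Longrightarrow> vnorm (M *\<^sub>v v) \<le> K * vnorm v"
    using vnorm_mult_mat_vec_bounded[OF M_carrier] by blast
  have form_abs: "\<bar>v \<bullet> (M *\<^sub>v v)\<bar> \<le> K * (v \<bullet> v)" if v: "v \<in> carrier_vec k" for v
  proof -
    have "\<bar>v \<bullet> (M *\<^sub>v v)\<bar> \<le> vnorm v * vnorm (M *\<^sub>v v)"
      using Cauchy_Schwarz_vnorm v by simp
    also have "\<dots> \<le> vnorm v * (K * vnorm v)"
      by (intro mult_left_mono K v) simp
    finally show ?thesis by (simp add: vnorm_sq[symmetric] power2_eq_square mult_ac)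
  qed
  have bdd: "bdd_below R"
  proof (rule bdd_belowI[of _ "- K"])
    fix r assume "r \<in> R"
    then obtain v where v: "v \<in> carrier_vec k" "v \<noteq> 0\<^sub>v k" "r = v \<bullet> (M *\<^sub>v v) / (v \<bullet> v)"
      by (auto simp: R_def)
    have "- K * (v \<bullet> v) \<le> v \<bullet> (M *\<^sub>v v)" using form_abs[OF v(1)] by linarith
    then show "- K \<le> r" using pos[OF v(1,2)] by (simp only: v(3) pos_le_divide_eq)
  qed
  have "unit_vec k 0 \<in> {v \<in> carrier_vec k. v \<noteq> 0\<^sub>v k}"
    using k by (auto dest: arg_cong[of _ _ "\<lambda>v. v $ 0"])
  then have R_ne: "R \<noteq> {}" unfolding R_def by blast
  define \<mu> where "\<mu> = Inf R"
  have lower: "\<mu> * (v \<bullet> v) \<le> v \<bullet> (M *\<^sub>v v)" if v: "v \<in> carrier_vec k" for v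
  proof (cases "v = 0\<^sub>v k")
    case True
    then show ?thesis using v by simp
  next
    case False
    then have "\<mu> \<le> v \<bullet> (M *\<^sub>v v) / (v \<bullet> v)"
      unfolding \<mu>_def by (intro cInf_lower bdd) (auto simp: R_def v)
    then show ?thesis using pos[OF v False] by (simp add: field_simps)
  qed
  define N where "N = M - \<mu> \<cdot>\<^sub>m 1\<^sub>m k"
  have N: "N \<in> carrier_mat k k"
    unfolding N_def by (intro minus_carrier_mat smult_carrier_mat one_carrier_mat)
  have "symmetric_mat k N"
  proof
    have "M $$ (j, i) = M $$ (i, j)" if "i < k" "j < k" for i j
      using arg_cong[OF M_symmetric, of "\<lambda>N. N $$ (i, j)"] that by simp
    then show "transpose_mat N = N" unfolding N_def by (intro eq_matI) auto
  qed (rule N)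
  then interpret N: symmetric_mat k N .
  have N_mult: "N *\<^sub>v v = M *\<^sub>v v - \<mu> \<cdot>\<^sub>v v" if v: "v \<in> carrier_vec k" for v
  proof -
    have "(\<mu> \<cdot>\<^sub>m 1\<^sub>m k) *\<^sub>v v = \<mu> \<cdot>\<^sub>v v"
      using v by (intro eq_vecI) (auto simp: scalar_prod_smult_left row_smult)
    then show ?thesis
      using minus_mult_distrib_mat_vec[OF M_carrier smult_carrier_mat[OF one_carrier_mat] v]
      by (simp add: N_def)
  qed
  have N_form: "v \<bullet> (N *\<^sub>v v) = v \<bullet> (M *\<^sub>v v) - \<mu> * (v \<bullet> v)" if v: "v \<in> carrier_vec k" for v
    using v by (simp add: N_mult scalar_prod_minus_distrib[of _ k])
  show thesis
  proof (rule that[OF _ lower])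
    show "eigenvalue M \<mu>"
    proof (rule ccontr)
      assume no: "\<not> eigenvalue M \<mu>"
      have inj: "v = 0\<^sub>v k" if v: "v \<in> carrier_vec k" "N *\<^sub>v v = 0\<^sub>v k" for v
      proof (rule ccontr)
        assume "v \<noteq> 0\<^sub>v k"
        moreover have "M *\<^sub>v v = \<mu> \<cdot>\<^sub>v v"
        proof (rule eq_vecI)
          fix i assume "i < dim_vec (\<mu> \<cdot>\<^sub>v v)"
          then show "(M *\<^sub>v v) $ i = (\<mu> \<cdot>\<^sub>v v) $ i"
            using v arg_cong[OF v(2)[unfolded N_mult[OF v(1)]], of "\<lambda>w. w $ i"] by auto
        qed (use v in auto)
        ultimately show False using no v by (auto simp: eigenvalue_def eigenvector_def)
      qed
      obtain L where L: "L * N = 1\<^sub>m k" "L \<in> carrier_mat k k"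
        using injective_square_mat_has_inverse[OF N inj] by metis
      obtain C where C: "0 \<le> C" "\<And>v. v \<in> carrier_vec k \<Longrightarrow> vnorm (L *\<^sub>v v) \<le> C * vnorm v"
        using vnorm_mult_mat_vec_bounded[OF L(2)] by blast
      define D where "D = K + \<bar>\<mu>\<bar>"
      have D: "0 \<le> D" using K(1) by (simp add: D_def)
      have N_psd: "0 \<le> w \<bullet> (N *\<^sub>v w)" if "w \<in> carrier_vec k" for w
        using lower[OF that] N_form[OF that] by simp
      have N_upper: "w \<bullet> (N *\<^sub>v w) \<le> D * (w \<bullet> w)" if "w \<in> carrier_vec k" for w
      proof -
        have "- \<mu> * (w \<bullet> w) \<le> \<bar>\<mu>\<bar> * (w \<bullet> w)"
          by (intro mult_right_mono scalar_prod_self_nonneg) simp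
        then show ?thesis
          using form_abs[OF that] N_form[OF that] by (simp add: D_def algebra_simps)
      qed
      have bound: "v \<bullet> v \<le> C\<^sup>2 * D * (v \<bullet> (N *\<^sub>v v))" if v: "v \<in> carrier_vec k" for v
      proof -
        have "v = L *\<^sub>v (N *\<^sub>v v)"
          using L v N by (simp flip: assoc_mult_mat_vec[OF L(2) N v])
        then have "vnorm v \<le> C * vnorm (N *\<^sub>v v)" using C(2)[of "N *\<^sub>v v"] v by simp
        then have "(vnorm v)\<^sup>2 \<le> (C * vnorm (N *\<^sub>v v))\<^sup>2"
          by (rule power_mono) simp
        also have "\<dots> = C\<^sup>2 * (vnorm (N *\<^sub>v v))\<^sup>2"
          by (rule power_mult_distrib)
        also have "\<dots> \<le> C\<^sup>2 * (D * (v \<bullet> (N *\<^sub>v v)))"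
          by (intro mult_left_mono N.vnorm_mult_sq_le_form N_psd N_upper D v zero_le_power2)
        finally show ?thesis by (simp add: vnorm_sq mult.assoc)
      qed
      \<comment> \<open>the amount by which the Rayleigh quotient would exceed its infimum everywhere\<close>
      define e where "e = 1 / (C\<^sup>2 * D + 1)"
      have e: "0 < C\<^sup>2 * D + 1" "0 < e" using D by (auto simp: e_def add_nonneg_pos)
      have "\<mu> + e \<le> r" if r: "r \<in> R" for r
      proof -
        obtain v where v: "v \<in> carrier_vec k" "v \<noteq> 0\<^sub>v k" "r = v \<bullet> (M *\<^sub>v v) / (v \<bullet> v)"
          using r by (auto simp: R_def)
        have "v \<bullet> v \<le> (C\<^sup>2 * D + 1) * (v \<bullet> (N *\<^sub>v v))"
          using bound[OF v(1)] N_psd[OF v(1)] by (simp add: algebra_simps)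
        then have "e * (v \<bullet> v) \<le> v \<bullet> (N *\<^sub>v v)"
          using e(1) by (simp add: e_def field_simps)
        then have "(\<mu> + e) * (v \<bullet> v) \<le> v \<bullet> (M *\<^sub>v v)"
          by (simp add: N_form[OF v(1)] algebra_simps)
        then show ?thesis using pos[OF v(1,2)] by (simp only: v(3) pos_le_divide_eq)
      qed
      then have "\<mu> + e \<le> \<mu>" unfolding \<mu>_def using R_ne by (intro cInf_greatest) auto
      with e show False by simp
    qed
  qed
qed

lemma lam_min_le_form:
  assumes v: "v \<in> carrier_vec k"
  shows "lam_min M * (v \<bullet> v) \<le> v \<bullet> (M *\<^sub>v v)"
proof (cases "k = 0")
  case True
  then show ?thesis using v by (simp add: scalar_prod_def)
next
  case False
  then obtain \<mu> where \<mu>: "eigenvalue M \<mu>" "\<mu> * (v \<bullet> v) \<le> v \<bullet> (M *\<^sub>v v)"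
    using Rayleigh_infimum_eigenvalue v by blast
  have "lam_min M \<le> \<mu>"
    unfolding lam_min_def using card_finite_spectrum(1)[OF M_carrier] \<mu>(1)
    by (intro Min_le) (auto simp: spectrum_def)
  then have "lam_min M * (v \<bullet> v) \<le> \<mu> * (v \<bullet> v)"
    by (intro mult_right_mono scalar_prod_self_nonneg)
  with \<mu>(2) show ?thesis by linarith
qed

lemma lam_min_eigenvalue: "0 < k \<Longrightarrow> eigenvalue M (lam_min M)"
proof -
  assume "0 < k"
  then have "spectrum M \<noteq> {}" using Rayleigh_infimum_eigenvalue by (force simp: spectrum_def)
  then have "lam_min M \<in> spectrum M"
    unfolding lam_min_def by (intro Min_in card_finite_spectrum(1)[OF M_carrier])
  then show ?thesis by (simp add: spectrum_def)
qed

lemma form_le_lam_max: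
  assumes v: "v \<in> carrier_vec k"
  shows "v \<bullet> (M *\<^sub>v v) \<le> lam_max M * (v \<bullet> v)"
proof (cases "k = 0")
  case True
  then show ?thesis using v by (simp add: scalar_prod_def)
next
  case False
  \<comment> \<open>the greatest eigenvalue is the negated least eigenvalue of the negated matrix\<close>
  interpret neg: symmetric_mat k "- M"
    by unfold_locales (auto simp: M_symmetric transpose_uminus)
  have neg_mult: "(- M) *\<^sub>v w = - (M *\<^sub>v w)" if "w \<in> carrier_vec k" for w
    using that by simp
  obtain \<mu> where \<mu>: "eigenvalue (- M) \<mu>" "\<mu> * (v \<bullet> v) \<le> v \<bullet> ((- M) *\<^sub>v v)"
    using neg.Rayleigh_infimum_eigenvalue v False by blast
  obtain w where w: "w \<in> carrier_vec k" "w \<noteq> 0\<^sub>v k" "- (M *\<^sub>v w) = \<mu> \<cdot>\<^sub>v w"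
    using \<mu>(1) neg_mult by (auto simp: eigenvalue_def eigenvector_def)
  have "M *\<^sub>v w = (- \<mu>) \<cdot>\<^sub>v w"
  proof (rule eq_vecI)
    fix i assume "i < dim_vec ((- \<mu>) \<cdot>\<^sub>v w)"
    then show "(M *\<^sub>v w) $ i = ((- \<mu>) \<cdot>\<^sub>v w) $ i"
      using w(1) arg_cong[OF w(3), of "\<lambda>u. u $ i"] by auto
  qed (use w in auto)
  then have "- \<mu> \<in> spectrum M"
    using w by (auto simp: spectrum_def eigenvalue_def eigenvector_def)
  then have "- \<mu> \<le> lam_max M"
    unfolding lam_max_def by (intro Max_ge card_finite_spectrum(1)[OF M_carrier])
  then have "- \<mu> * (v \<bullet> v) \<le> lam_max M * (v \<bullet> v)"
    by (intro mult_right_mono scalar_prod_self_nonneg)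
  with \<mu>(2) show ?thesis using v by (simp add: neg_mult)
qed

end

locale pos_def_mat =
  fixes k :: nat and M :: "real mat"
  assumes pos_def: "sym_pos_def k M"
begin

sublocale symmetric_mat k M
  using pos_def by unfold_locales (auto simp: sym_pos_def_def)

lemma form_pos: "\<lbrakk>v \<in> carrier_vec k; v \<noteq> 0\<^sub>v k\<rbrakk> \<Longrightarrow> 0 < v \<bullet> (M *\<^sub>v v)"
  using pos_def by (auto simp: sym_pos_def_def)

lemma form_nonneg: "v \<in> carrier_vec k \<Longrightarrow> 0 \<le> v \<bullet> (M *\<^sub>v v)"
  using form_pos[of v] by (cases "v = 0\<^sub>v k") force+

lemma injective: "\<lbrakk>v \<in> carrier_vec k; M *\<^sub>v v = 0\<^sub>v k\<rbrakk> \<Longrightarrow> v = 0\<^sub>v k"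
  using form_pos[of v] by force

lemma lam_min_pos:
  assumes "0 < k"
  shows "0 < lam_min M"
proof -
  obtain v where v: "v \<in> carrier_vec k" "v \<noteq> 0\<^sub>v k" "M *\<^sub>v v = lam_min M \<cdot>\<^sub>v v"
    using lam_min_eigenvalue[OF assms] by (auto simp: eigenvalue_def eigenvector_def)
  then have "0 < lam_min M * (v \<bullet> v)" using form_pos[of v] by simp
  then show ?thesis using scalar_prod_self_nonneg[of v] by (simp add: zero_less_mult_iff)
qed

lemma lam_max_nonneg: "0 < k \<Longrightarrow> 0 \<le> lam_max M"
proof -
  assume k: "0 < k"
  let ?u = "unit_vec k 0 :: real vec"
  have "0 \<le> ?u \<bullet> (M *\<^sub>v ?u)" by (rule form_nonneg) simp
  also have "\<dots> \<le> lam_max M * (?u \<bullet> ?u)" by (rule form_le_lam_max) simp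
  finally show ?thesis using k by simp
qed

lemma vnorm_mult_le:
  assumes v: "v \<in> carrier_vec k"
  shows "vnorm (M *\<^sub>v v) \<le> lam_max M * vnorm v"
proof (cases "k = 0")
  case True
  then show ?thesis using v vnorm_dim_0[of v] vnorm_dim_0[of "M *\<^sub>v v"] mult_M_carrier[OF v] by simp
next
  case False
  then have nonneg: "0 \<le> lam_max M" by (simp add: lam_max_nonneg)
  have "(vnorm (M *\<^sub>v v))\<^sup>2 \<le> lam_max M * (v \<bullet> (M *\<^sub>v v))"
    by (intro vnorm_mult_sq_le_form form_nonneg form_le_lam_max nonneg v)
  also have "\<dots> \<le> lam_max M * (lam_max M * (v \<bullet> v))"
    by (intro mult_left_mono form_le_lam_max v nonneg)
  also have "\<dots> = (lam_max M * vnorm v)\<^sup>2"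
    by (simp add: power2_eq_square mult_ac flip: vnorm_sq)
  finally show ?thesis by (rule power2_le_imp_le) (simp add: nonneg)
qed

end

section \<open>Restriction to a free set\<close>

text \<open>Each operation of the inner solve on \<open>F\<close> is the corresponding operation of the full problem
  on zero extensions. Everything that happens on \<open>F\<close> is transferred to dimension \<open>n\<close> in this way.\<close>

locale index_subset =
  fixes n :: nat and F :: "nat set"
  assumes F_subset: "F \<subseteq> {0..<n}"
begin

lemma finite_F [simp]: "finite F"
  using F_subset by (rule finite_subset) simp

lemma restrict_F: "{i. i < n \<and> i \<in> F} = F"
  using F_subset by auto

lemma pick_F [simp]: "k < card F \<Longrightarrow> pick F k \<in> F" "k < card F \<Longrightarrow> pick F k < n"
  using pick_in_set_le[of k F] F_subset by auto

lemma bij_betw_pick: "bij_betw (pick F) {0..<card F} F"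
proof -
  have "inj_on (pick F) {0..<card F}"
    by (rule strict_mono_on_imp_inj_on) (auto simp: strict_mono_on_def pick_mono_le)
  moreover have "pick F ` {0..<card F} \<subseteq> F" by auto
  ultimately show ?thesis
    by (metis bij_betw_def card_atLeastLessThan card_image card_subset_eq diff_zero finite_F)
qed

lemma obtain_pick:
  assumes "i \<in> F"
  obtains k where "k < card F" "i = pick F k"
  using assms bij_betw_pick by (force simp: bij_betw_def)

lemma subvec_carrier [simp]: "v \<in> carrier_vec n \<Longrightarrow> subvec v F \<in> carrier_vec (card F)"
  by (simp add: subvec_def restrict_F)

lemma index_subvec [simp]:
  "\<lbrakk>v \<in> carrier_vec n; k < card F\<rbrakk> \<Longrightarrow> subvec v F $ k = v $ pick F k"
  by (simp add: subvec_def restrict_F)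

lemma psub_carrier [simp]: "A \<in> carrier_mat n n \<Longrightarrow> psub A F \<in> carrier_mat (card F) (card F)"
  by (intro carrier_matI) (auto simp: dim_submatrix restrict_F)

lemma csub_carrier [simp]: "B \<in> carrier_mat p n \<Longrightarrow> csub B F \<in> carrier_mat p (card F)"
  by (intro carrier_matI) (auto simp: dim_submatrix restrict_F)

lemma index_psub:
  "\<lbrakk>A \<in> carrier_mat n n; i < card F; j < card F\<rbrakk>
    \<Longrightarrow> psub A F $$ (i, j) = A $$ (pick F i, pick F j)"
  by (subst submatrix_index) (auto simp: restrict_F)

lemma index_csub:
  "\<lbrakk>B \<in> carrier_mat p n; i < p; j < card F\<rbrakk> \<Longrightarrow> csub B F $$ (i, j) = B $$ (i, pick F j)"
  by (subst submatrix_index) (auto simp: restrict_F pick_UNIV)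

lemma zext_carrier [simp]: "zext n F y \<in> carrier_vec n"
  by (simp add: zext_def)

lemma index_zext_pick [simp]: "k < card F \<Longrightarrow> zext n F y $ pick F k = y $ k"
  by (simp add: zext_def card_pick_le)

lemma index_zext_outside [simp]: "\<lbrakk>i < n; i \<notin> F\<rbrakk> \<Longrightarrow> zext n F y $ i = 0"
  by (simp add: zext_def)

lemma zext_eqI:
  assumes "x \<in> carrier_vec n" "\<And>k. k < card F \<Longrightarrow> x $ pick F k = y $ k"
    "\<And>i. \<lbrakk>i < n; i \<notin> F\<rbrakk> \<Longrightarrow> x $ i = 0"
  shows "x = zext n F y"
proof (rule eq_vecI)
  fix i assume "i < dim_vec (zext n F y)"
  then have i: "i < n" by (simp add: zext_def)
  show "x $ i = zext n F y $ i"
  proof (cases "i \<in> F")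
    case True
    then obtain k where "k < card F" "i = pick F k" by (rule obtain_pick)
    then show ?thesis using assms(2) by simp
  qed (use assms(3) i in simp)
qed (use assms(1) in \<open>simp add: zext_def\<close>)

lemma zext_minus:
  assumes "y \<in> carrier_vec (card F)" "z \<in> carrier_vec (card F)"
  shows "zext n F y - zext n F z = zext n F (y - z)"
proof (rule zext_eqI)
  show "zext n F y - zext n F z \<in> carrier_vec n" by (intro minus_carrier_vec) simp_all
  have [simp]: "dim_vec (zext n F z) = n" by (simp add: zext_def)
  show "(zext n F y - zext n F z) $ pick F k = (y - z) $ k" if "k < card F" for k
    using that assms by simp
  show "(zext n F y - zext n F z) $ i = 0" if "i < n" "i \<notin> F" for i
    using that by simp
qed

lemma sum_zext:
  "(\<Sum>i\<in>{0..<n}. f i * zext n F y $ i) = (\<Sum>k\<in>{0..<card F}. f (pick F k) * y $ k)"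
  for f :: "nat \<Rightarrow> real"
proof -
  have "(\<Sum>i\<in>{0..<n}. f i * zext n F y $ i) = (\<Sum>i\<in>F. f i * zext n F y $ i)"
    by (rule sum.mono_neutral_right) (use F_subset in auto)
  also have "\<dots> = (\<Sum>k\<in>{0..<card F}. f (pick F k) * zext n F y $ pick F k)"
    by (rule sum.reindex_bij_betw[OF bij_betw_pick, symmetric])
  finally show ?thesis by simp
qed

lemma scalar_prod_zext:
  assumes "x \<in> carrier_vec n" "y \<in> carrier_vec (card F)"
  shows "x \<bullet> zext n F y = subvec x F \<bullet> y"
  using sum_zext[of "vec_index x" y] assms by (simp add: scalar_prod_def zext_def)

lemma subvec_zext: "y \<in> carrier_vec (card F) \<Longrightarrow> subvec (zext n F y) F = y"
  by (intro eq_vecI) (simp_all add: carrier_vecD[OF subvec_carrier[OF zext_carrier]] carrier_vecD)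

lemma vnorm_zext: "y \<in> carrier_vec (card F) \<Longrightarrow> vnorm (zext n F y) = vnorm y"
  by (simp add: vnorm_def scalar_prod_zext subvec_zext)

lemma csub_mult:
  assumes "B \<in> carrier_mat p n" "y \<in> carrier_vec (card F)"
  shows "csub B F *\<^sub>v y = B *\<^sub>v zext n F y"
proof (rule eq_vecI)
  fix i assume "i < dim_vec (B *\<^sub>v zext n F y)"
  then have i: "i < p" using assms by simp
  have "(B *\<^sub>v zext n F y) $ i = (\<Sum>j\<in>{0..<n}. B $$ (i, j) * zext n F y $ j)"
    using assms i by (simp add: scalar_prod_def zext_def)
  also have "\<dots> = (csub B F *\<^sub>v y) $ i"
    unfolding sum_zext using assms i csub_carrier[OF assms(1)]
    by (auto simp: scalar_prod_def index_csub carrier_matD[OF csub_carrier[OF assms(1)]])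
  finally show "(csub B F *\<^sub>v y) $ i = (B *\<^sub>v zext n F y) $ i" by simp
qed (use assms carrier_matD[OF csub_carrier[OF assms(1)]] in auto)

lemma psub_mult:
  assumes "A \<in> carrier_mat n n" "y \<in> carrier_vec (card F)"
  shows "psub A F *\<^sub>v y = subvec (A *\<^sub>v zext n F y) F"
proof (rule eq_vecI)
  have Az: "A *\<^sub>v zext n F y \<in> carrier_vec n" using assms by simp
  then have dim: "dim_vec (subvec (A *\<^sub>v zext n F y) F) = card F"
    using subvec_carrier by auto
  fix k assume "k < dim_vec (subvec (A *\<^sub>v zext n F y) F)"
  then have k: "k < card F" by (simp add: dim)
  have "subvec (A *\<^sub>v zext n F y) F $ k = (\<Sum>j\<in>{0..<n}. A $$ (pick F k, j) * zext n F y $ j)"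
    using assms k by (simp add: Az scalar_prod_def zext_def)
  also have "\<dots> = (psub A F *\<^sub>v y) $ k"
    unfolding sum_zext using assms k
    by (auto simp: scalar_prod_def index_psub carrier_matD[OF psub_carrier[OF assms(1)]])
  finally show "(psub A F *\<^sub>v y) $ k = subvec (A *\<^sub>v zext n F y) F $ k" by simp
next
  have "A *\<^sub>v zext n F y \<in> carrier_vec n" using assms by simp
  then have "dim_vec (subvec (A *\<^sub>v zext n F y) F) = card F"
    by (rule carrier_vecD[OF subvec_carrier])
  then show "dim_vec (psub A F *\<^sub>v y) = dim_vec (subvec (A *\<^sub>v zext n F y) F)"
    using carrier_matD[OF psub_carrier[OF assms(1)]] by simp
qed

lemma csub_transpose_mult:
  assumes "B \<in> carrier_mat p n" "w \<in> carrier_vec p"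
  shows "transpose_mat (csub B F) *\<^sub>v w = subvec (transpose_mat B *\<^sub>v w) F"
proof (rule eq_vecI)
  have Bw: "transpose_mat B *\<^sub>v w \<in> carrier_vec n" using assms by auto
  then have dim: "dim_vec (subvec (transpose_mat B *\<^sub>v w) F) = card F" using subvec_carrier by auto
  then show "dim_vec (transpose_mat (csub B F) *\<^sub>v w) = dim_vec (subvec (transpose_mat B *\<^sub>v w) F)"
    using carrier_matD[OF csub_carrier[OF assms(1)]] by simp
  fix k assume "k < dim_vec (subvec (transpose_mat B *\<^sub>v w) F)"
  then have k: "k < card F" by (simp add: dim)
  then show "(transpose_mat (csub B F) *\<^sub>v w) $ k = subvec (transpose_mat B *\<^sub>v w) F $ k"
    using assms Bw carrier_matD[OF csub_carrier[OF assms(1)]]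
    by (auto simp: scalar_prod_def index_csub)
qed

lemma form_psub:
  assumes "A \<in> carrier_mat n n" "y \<in> carrier_vec (card F)"
  shows "y \<bullet> (psub A F *\<^sub>v y) = zext n F y \<bullet> (A *\<^sub>v zext n F y)"
proof -
  have Az: "A *\<^sub>v zext n F y \<in> carrier_vec n" using assms by simp
  have "zext n F y \<bullet> (A *\<^sub>v zext n F y) = subvec (A *\<^sub>v zext n F y) F \<bullet> y"
    using scalar_prod_zext[OF Az assms(2)] comm_scalar_prod[OF zext_carrier Az] by simp
  also have "\<dots> = y \<bullet> (psub A F *\<^sub>v y)"
    using comm_scalar_prod[OF assms(2) subvec_carrier[OF Az]] assms by (simp add: psub_mult)
  finally show ?thesis by simp
qed

lemma psub_sym_pos_def:
  assumes A: "sym_pos_def n A"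
  shows "sym_pos_def (card F) (psub A F)"
proof -
  have Ac: "A \<in> carrier_mat n n" and At: "transpose_mat A = A" using A by (auto simp: sym_pos_def_def)
  have sym: "A $$ (j, i) = A $$ (i, j)" if "i < n" "j < n" for i j
    using arg_cong[OF At, of "\<lambda>N. N $$ (i, j)"] that Ac by simp
  have "transpose_mat (psub A F) = psub A F"
    using carrier_matD[OF psub_carrier[OF Ac]]
    by (intro eq_matI) (auto simp: index_psub[OF Ac] sym)
  moreover have "0 < v \<bullet> (psub A F *\<^sub>v v)" if v: "v \<in> carrier_vec (card F)" "v \<noteq> 0\<^sub>v (card F)" for v
  proof -
    have "zext n F v \<noteq> 0\<^sub>v n"
    proof
      assume "zext n F v = 0\<^sub>v n"
      then have "vnorm v = 0" using vnorm_zext[OF v(1)] by simp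
      with v show False by (simp add: vnorm_eq_0D)
    qed
    then show ?thesis using A form_psub[OF Ac v(1)] by (auto simp: sym_pos_def_def)
  qed
  ultimately show ?thesis using psub_carrier[OF Ac] by (auto simp: sym_pos_def_def)
qed

end

text \<open>The columns of a matrix of full row rank span the whole space, in particular \<open>w\<close> itself;
  a vector orthogonal to all columns is thus orthogonal to itself.\<close>

lemma full_row_rank_transpose_injective:
  assumes M: "M \<in> carrier_mat p m" and rank: "full_row_rank M"
    and w: "w \<in> carrier_vec p" "transpose_mat M *\<^sub>v w = 0\<^sub>v m"
  shows "w = 0\<^sub>v p"
proof -
  interpret vec_space "TYPE(real)" p .
  let ?C = "set (cols M)"
  have C: "?C \<subseteq> carrier_vec p" using M cols_dim by blast
  have "finite {}" "{} \<subseteq> ?C \<and> lin_indpt {}" by (auto simp: lin_dep_def)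
  then obtain U where U: "maximal U (\<lambda>T. T \<subseteq> ?C \<and> lin_indpt T)"
    using maximal_exists_superset[of ?C "\<lambda>T. T \<subseteq> ?C \<and> lin_indpt T" "{}"] by auto
  have "card U = p"
    using rank_card_indpt[OF M U] rank M by (simp add: full_row_rank_def)
  moreover have U': "U \<subseteq> ?C" "lin_indpt U" using U by (auto simp: maximal_def)
  moreover have "finite U" using U'(1) finite_subset by blast
  ultimately have "basis U"
    using C by (intro dim_li_is_basis) (auto simp: dim_is_n)
  then have "span U = carrier_vec p" by (simp add: basis_def)
  moreover have "span U \<subseteq> span ?C" using U'(1) by (rule span_is_monotone)
  ultimately have "w \<in> col_space M" using w(1) by (auto simp: col_space_def)
  then obtain x where x: "x \<in> carrier_vec m" "M *\<^sub>v x = w"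
    using col_space_eq[OF M] M by auto
  have "w \<bullet> w = (transpose_mat M *\<^sub>v w) \<bullet> x"
    using transpose_vec_mult_scalar[OF M x(1) w(1)] x(2) by simp
  then have "vnorm w = 0" using w(2) x(1) by (simp add: vnorm_def)
  then show ?thesis using w(1) by (rule vnorm_eq_0D[rotated])
qed

section \<open>The inner solve on a free set\<close>

lemma minv_inverse:
  assumes M: "M \<in> carrier_mat k k"
    and inj: "\<And>v. \<lbrakk>v \<in> carrier_vec k; M *\<^sub>v v = 0\<^sub>v k\<rbrakk> \<Longrightarrow> v = 0\<^sub>v k"
  shows "minv M \<in> carrier_mat k k" "M * minv M = 1\<^sub>m k" "minv M * M = 1\<^sub>m k"
proof -
  obtain N where "mat_inverse M = Some N" "M * N = 1\<^sub>m k" "N * M = 1\<^sub>m k" "N \<in> carrier_mat k k"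
    using injective_square_mat_has_inverse[OF M inj] by blast
  then show "minv M \<in> carrier_mat k k" "M * minv M = 1\<^sub>m k" "minv M * M = 1\<^sub>m k"
    by (simp_all add: minv_def)
qed

lemma vec_diff_split:
  fixes a b d e f :: "real vec"
  assumes "a \<in> carrier_vec k" "b \<in> carrier_vec k" "d \<in> carrier_vec k" "e \<in> carrier_vec k"
    "f \<in> carrier_vec k"
  shows "(a + d) - (b + e) = (a - b) + ((f - e) + (d - f))"
  using assms by (intro eq_vecI) auto

lemma vec_residual_split:
  fixes u v w z :: "real vec"
  assumes "z \<in> carrier_vec k" "u \<in> carrier_vec k" "v \<in> carrier_vec k" "w \<in> carrier_vec k"
  shows "(z - u) - w = - ((u - v) + (w - (z - v)))"
  using assms by (intro eq_vecI) auto

lemma gradient_diff: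
  fixes u v w z z' :: "real vec"
  assumes "u \<in> carrier_vec k" "v \<in> carrier_vec k" "w \<in> carrier_vec k" "z \<in> carrier_vec k"
    "z' \<in> carrier_vec k"
  shows "(u - w - z) - (v - w - z') = (u - v) - (z - z')"
  using assms by (intro eq_vecI) auto

lemma vec_minus_minus_add:
  "\<lbrakk>u \<in> carrier_vec k; v \<in> carrier_vec k; w \<in> carrier_vec k\<rbrakk> \<Longrightarrow> u = (u - v - w) + (v + w)"
  for u v w :: "real vec"
  by (intro eq_vecI) auto

lemma vec_add_diff: "\<lbrakk>u \<in> carrier_vec k; v \<in> carrier_vec k\<rbrakk> \<Longrightarrow> u + (v - u) = v"
  for u v :: "real vec"
  by (intro eq_vecI) auto

lemma vnorm_diff_le:
  assumes "u \<in> carrier_vec k" "v \<in> carrier_vec k"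
  shows "vnorm u \<le> vnorm v + vnorm (v - u)"
proof -
  have "u = v + (u - v)" using assms by (intro eq_vecI) auto
  then have "vnorm u \<le> vnorm v + vnorm (u - v)"
    using vnorm_triangle[OF assms(2), of "u - v"] assms by simp
  then show ?thesis using vnorm_minus_commute[OF assms] by simp
qed

locale eq_qp =
  fixes n p :: nat and A B :: "real mat" and b c :: "real vec"
  assumes A: "sym_pos_def n A"
    and b: "b \<in> carrier_vec n"
    and B: "B \<in> carrier_mat p n"
    and c: "c \<in> carrier_vec p"
begin

sublocale pos_def_mat n A
  by unfold_locales (rule A)

lemma dim_B: "dim_row B = p" "dim_col B = n"
  using carrier_matD[OF B] by auto

end

locale free_set_solve = eq_qp n p A B b c + index_subset n F for n p A B b c F +
  assumes rank: "full_row_rank (csub B F)"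
begin

abbreviation m where "m \<equiv> card F"
abbreviation AF where "AF \<equiv> psub A F"
abbreviation BF where "BF \<equiv> csub B F"
abbreviation S where "S \<equiv> S_ex A B F"
abbreviation lam where "lam \<equiv> lam_ex A b B c F"

sublocale AF: pos_def_mat m AF
  by unfold_locales (rule psub_sym_pos_def[OF A])

lemmas BF = csub_carrier[OF B]

lemma BFt: "transpose_mat BF \<in> carrier_mat m p"
  using BF by simp

lemma BFt_mult: "w \<in> carrier_vec p \<Longrightarrow> transpose_mat BF *\<^sub>v w \<in> carrier_vec m"
  by (rule mult_mat_vec_carrier[OF BFt])

lemma BFt_injective: "\<lbrakk>w \<in> carrier_vec p; transpose_mat BF *\<^sub>v w = 0\<^sub>v m\<rbrakk> \<Longrightarrow> w = 0\<^sub>v p"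
  by (rule full_row_rank_transpose_injective[OF BF rank])

lemmas AF_inverse = minv_inverse[OF AF.M_carrier AF.injective]

text \<open>Zero extension preserves the norm as well as the form, so that the form of a principal submatrix
  inherits the lower bound.\<close>

lemma AF_coercive:
  assumes v: "v \<in> carrier_vec m"
  shows "lam_min A * vnorm v \<le> vnorm (AF *\<^sub>v v)"
proof (rule vnorm_geI[OF v])
  have "v \<bullet> v = zext n F v \<bullet> zext n F v"
    using v by (simp add: scalar_prod_zext subvec_zext)
  then show "lam_min A * (v \<bullet> v) \<le> v \<bullet> (AF *\<^sub>v v)"
    using lam_min_le_form[OF zext_carrier[of v]] v by (simp add: form_psub)
qed (use v in simp)

lemma v0_ex: "v0_ex A b F \<in> carrier_vec m" "AF *\<^sub>v v0_ex A b F = subvec b F"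
proof -
  show "v0_ex A b F \<in> carrier_vec m"
    unfolding v0_ex_def by (rule mult_mat_vec_carrier[OF AF_inverse(1) subvec_carrier[OF b]])
  have "AF *\<^sub>v v0_ex A b F = (AF * minv AF) *\<^sub>v subvec b F"
    unfolding v0_ex_def
    by (rule assoc_mult_mat_vec[OF AF.M_carrier AF_inverse(1) subvec_carrier[OF b], symmetric])
  then show "AF *\<^sub>v v0_ex A b F = subvec b F"
    using subvec_carrier[OF b] by (simp add: AF_inverse(2))
qed

lemma V1_ex: "V1_ex A B F \<in> carrier_mat m p"
  unfolding V1_ex_def by (rule mult_carrier_mat[OF AF_inverse(1) BFt])

lemma AF_V1_ex:
  assumes w: "w \<in> carrier_vec p"
  shows "AF *\<^sub>v (V1_ex A B F *\<^sub>v w) = transpose_mat BF *\<^sub>v w"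
proof -
  have "AF *\<^sub>v (V1_ex A B F *\<^sub>v w) = AF *\<^sub>v (minv AF *\<^sub>v (transpose_mat BF *\<^sub>v w))"
    unfolding V1_ex_def by (simp only: assoc_mult_mat_vec[OF AF_inverse(1) BFt w])
  also have "\<dots> = (AF * minv AF) *\<^sub>v (transpose_mat BF *\<^sub>v w)"
    by (rule assoc_mult_mat_vec[OF AF.M_carrier AF_inverse(1) BFt_mult[OF w], symmetric])
  finally show ?thesis using BFt_mult[OF w] by (simp add: AF_inverse(2))
qed

lemma schur_carrier: "V \<in> carrier_mat m p \<Longrightarrow> schur B F V \<in> carrier_mat p p"
  unfolding schur_def by (rule mult_carrier_mat[OF BF])

lemma schur_mult:
  "\<lbrakk>V \<in> carrier_mat m p; w \<in> carrier_vec p\<rbrakk> \<Longrightarrow> schur B F V *\<^sub>v w = BF *\<^sub>v (V *\<^sub>v w)"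
  unfolding schur_def by (rule assoc_mult_mat_vec[OF BF])

text \<open>The exact Schur complement represents the form of the inverse of \<open>A\<^sub>F\<close> on the
  range of the transpose of \<open>B\<^sub>F\<close>, which is injective by the rank condition.\<close>

lemma S_sym_pos_def: "sym_pos_def p S"
proof -
  let ?N = "minv AF" and ?Bt = "transpose_mat BF"
  have N: "?N \<in> carrier_mat m m" by (rule AF_inverse(1))
  have Nt: "transpose_mat ?N \<in> carrier_mat m m" using N by simp
  have "transpose_mat ?N * AF = transpose_mat (AF * ?N)"
    using transpose_mult[OF AF.M_carrier N] by (simp add: AF.M_symmetric)
  then have NtA: "transpose_mat ?N * AF = 1\<^sub>m m" by (simp add: AF_inverse(2))
  have "transpose_mat ?N = transpose_mat ?N * (AF * ?N)" using Nt by (simp add: AF_inverse(2))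
  also have "\<dots> = ?N" using assoc_mult_mat[OF Nt AF.M_carrier N] N by (simp add: NtA)
  finally have N_sym: "transpose_mat ?N = ?N" .
  have NB: "?N * ?Bt \<in> carrier_mat m p" by (rule mult_carrier_mat[OF N BFt])
  have "transpose_mat S = transpose_mat (?N * ?Bt) * ?Bt"
    unfolding S_ex_def schur_def V1_ex_def by (rule transpose_mult[OF BF NB])
  also have "\<dots> = BF * ?N * ?Bt"
    using transpose_mult[OF N BFt] by (simp add: N_sym)
  also have "\<dots> = S"
    unfolding S_ex_def schur_def V1_ex_def by (rule assoc_mult_mat[OF BF N BFt])
  finally have S_sym: "transpose_mat S = S" .
  have "0 < w \<bullet> (S *\<^sub>v w)" if w: "w \<in> carrier_vec p" "w \<noteq> 0\<^sub>v p" for w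
  proof -
    define z where "z = V1_ex A B F *\<^sub>v w"
    have z: "z \<in> carrier_vec m" "AF *\<^sub>v z = ?Bt *\<^sub>v w"
      unfolding z_def using mult_mat_vec_carrier[OF V1_ex w(1)] AF_V1_ex[OF w(1)] by auto
    have "AF *\<^sub>v z \<noteq> 0\<^sub>v m" using BFt_injective w z by auto
    then have "z \<noteq> 0\<^sub>v m" using carrier_matD[OF AF.M_carrier] by auto
    then have "0 < z \<bullet> (AF *\<^sub>v z)" by (rule AF.form_pos[OF z(1)])
    also have "\<dots> = (?Bt *\<^sub>v w) \<bullet> z"
      unfolding z(2) by (rule comm_scalar_prod[OF z(1) BFt_mult[OF w(1)]])
    also have "\<dots> = w \<bullet> (BF *\<^sub>v z)" by (rule transpose_vec_mult_scalar[OF BF z(1) w(1)])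
    finally show ?thesis
      using schur_mult[OF V1_ex w(1)] by (simp add: S_ex_def z_def)
  qed
  then show ?thesis
    using S_sym schur_carrier[OF V1_ex] by (simp add: sym_pos_def_def S_ex_def)
qed

sublocale S: pos_def_mat p S
  by unfold_locales (rule S_sym_pos_def)

text \<open>Covers both the exact and the approximate inner solve: their multipliers differ only in the
  pair \<open>(v\<^sub>0, V\<^sub>1)\<close>.\<close>

lemma multiplier_solves:
  assumes v0: "v0 \<in> carrier_vec m" and V1: "V1 \<in> carrier_mat m p"
    and inj: "\<And>w. \<lbrakk>w \<in> carrier_vec p; schur B F V1 *\<^sub>v w = 0\<^sub>v p\<rbrakk> \<Longrightarrow> w = 0\<^sub>v p"
  shows "multiplier B c F v0 V1 \<in> carrier_vec p"
    "schur B F V1 *\<^sub>v multiplier B c F v0 V1 = c - BF *\<^sub>v v0"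
proof -
  note N = minv_inverse[OF schur_carrier[OF V1] inj]
  have r: "c - BF *\<^sub>v v0 \<in> carrier_vec p"
    by (rule minus_carrier_vec[OF c mult_mat_vec_carrier[OF BF v0]])
  show "multiplier B c F v0 V1 \<in> carrier_vec p"
    unfolding multiplier_def by (rule mult_mat_vec_carrier[OF N(1) r])
  have "schur B F V1 *\<^sub>v multiplier B c F v0 V1
      = (schur B F V1 * minv (schur B F V1)) *\<^sub>v (c - BF *\<^sub>v v0)"
    unfolding multiplier_def by (rule assoc_mult_mat_vec[OF schur_carrier[OF V1] N(1) r, symmetric])
  then show "schur B F V1 *\<^sub>v multiplier B c F v0 V1 = c - BF *\<^sub>v v0"
    using r by (simp add: N(2))
qed

lemma lam: "lam \<in> carrier_vec p" "S *\<^sub>v lam = c - BF *\<^sub>v v0_ex A b F"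
  using multiplier_solves[OF v0_ex(1) V1_ex S.injective[unfolded S_ex_def]]
  by (auto simp: lam_ex_def S_ex_def)

lemma xF_ex: "xF_ex A b B c F = v0_ex A b F + V1_ex A B F *\<^sub>v lam"
  by (simp add: xF_ex_def xF_def lam_ex_def)

lemma xF_ex_carrier: "xF_ex A b B c F \<in> carrier_vec m"
  unfolding xF_ex using v0_ex(1) mult_mat_vec_carrier[OF V1_ex lam(1)] by simp

lemma x_ex: "x_ex A b B c F = zext n F (xF_ex A b B c F)"
  by (simp add: x_ex_def xfull_def xF_ex_def)

lemma s_ex: "s_ex A b B c F = A *\<^sub>v x_ex A b B c F - b - transpose_mat B *\<^sub>v lam"
  by (simp add: s_ex_def redgrad_def x_ex_def lam_ex_def)

lemma x_ex_carrier: "x_ex A b B c F \<in> carrier_vec n"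
  by (simp add: x_ex)

lemma Bt_mult: "w \<in> carrier_vec p \<Longrightarrow> transpose_mat B *\<^sub>v w \<in> carrier_vec n"
  using B by auto

lemma s_ex_carrier: "s_ex A b B c F \<in> carrier_vec n"
  unfolding s_ex
  by (rule minus_carrier_vec[OF minus_carrier_vec[OF mult_M_carrier[OF x_ex_carrier] b]
        Bt_mult[OF lam(1)]])

lemma B_x_ex: "B *\<^sub>v x_ex A b B c F = c"
proof -
  let ?v = "BF *\<^sub>v v0_ex A b F"
  have v: "?v \<in> carrier_vec p" using mult_mat_vec_carrier[OF BF v0_ex(1)] .
  have "B *\<^sub>v x_ex A b B c F = BF *\<^sub>v (v0_ex A b F + V1_ex A B F *\<^sub>v lam)"
    using csub_mult[OF B xF_ex_carrier] by (simp add: x_ex xF_ex)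
  also have "\<dots> = ?v + BF *\<^sub>v (V1_ex A B F *\<^sub>v lam)"
    by (rule mult_add_distrib_mat_vec[OF BF v0_ex(1) mult_mat_vec_carrier[OF V1_ex lam(1)]])
  also have "\<dots> = ?v + (c - ?v)"
    using schur_mult[OF V1_ex lam(1)] lam(2) by (simp add: S_ex_def)
  also have "\<dots> = c" by (rule vec_add_diff[OF v c])
  finally show ?thesis .
qed

text \<open>The multiplier is chosen such that the reduced gradient vanishes on the free set: there,
  \<open>A\<^sub>F x\<^sub>F = b\<^sub>F + B\<^sub>F\<^sup>T \<lambda>\<close> by the definition of \<open>v\<^sub>0\<close> and \<open>V\<^sub>1\<close>.\<close>

lemma s_ex_zero:
  assumes "i \<in> F"
  shows "s_ex A b B c F $ i = 0"
proof -
  obtain k where k: "k < m" "i = pick F k" using assms by (rule obtain_pick)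
  have V: "V1_ex A B F *\<^sub>v lam \<in> carrier_vec m" by (rule mult_mat_vec_carrier[OF V1_ex lam(1)])
  have "subvec (A *\<^sub>v x_ex A b B c F) F = AF *\<^sub>v (v0_ex A b F + V1_ex A B F *\<^sub>v lam)"
    using psub_mult[OF M_carrier xF_ex_carrier] by (simp add: x_ex xF_ex)
  also have "\<dots> = subvec b F + subvec (transpose_mat B *\<^sub>v lam) F"
    using mult_add_distrib_mat_vec[OF AF.M_carrier v0_ex(1) V]
    by (simp add: v0_ex(2) AF_V1_ex[OF lam(1)] csub_transpose_mult[OF B lam(1)])
  finally have "subvec (A *\<^sub>v x_ex A b B c F) F $ k
      = (subvec b F + subvec (transpose_mat B *\<^sub>v lam) F) $ k" by simp
  then have "(A *\<^sub>v x_ex A b B c F) $ pick F k = b $ pick F k + (transpose_mat B *\<^sub>v lam) $ pick F k"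
    using k(1) b mult_M_carrier[OF x_ex_carrier] Bt_mult[OF lam(1)]
      carrier_vecD[OF subvec_carrier[OF b]] carrier_vecD[OF subvec_carrier[OF Bt_mult[OF lam(1)]]]
    by (simp del: index_mult_mat_vec)
  moreover have "pick F k < n" using k(1) by simp
  ultimately show ?thesis
    using b carrier_vecD[OF Bt_mult[OF lam(1)]] by (simp add: s_ex k(2) del: index_mult_mat_vec)
qed

lemma x_ex_zero: "\<lbrakk>i < n; i \<notin> F\<rbrakk> \<Longrightarrow> x_ex A b B c F $ i = 0"
  by (simp add: x_ex)

end

section \<open>Perturbation of the inner solve\<close>

locale inexact_solve = free_set_solve n p A B b c F for n p A B b c F +
  fixes v0 :: "real vec" and V1 :: "real mat"
  assumes adm: "admissible A B F v0 V1"
begin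

abbreviation lam' where "lam' \<equiv> multiplier B c F v0 V1"
abbreviation r0 where "r0 \<equiv> rho0 A b F v0"
abbreviation r1 where "r1 \<equiv> rho1 A B F V1"

lemma v0: "v0 \<in> carrier_vec m" and V1: "V1 \<in> carrier_mat m p"
  and star: "r1 * spectral_norm BF \<le> 1 / 2 * lam_min A * lam_min S"
  using adm by (auto simp: admissible_def dim_B)

lemma V1_mult: "w \<in> carrier_vec p \<Longrightarrow> V1 *\<^sub>v w \<in> carrier_vec m"
  by (rule mult_mat_vec_carrier[OF V1])

lemma V1_ex_mult: "w \<in> carrier_vec p \<Longrightarrow> V1_ex A B F *\<^sub>v w \<in> carrier_vec m"
  by (rule mult_mat_vec_carrier[OF V1_ex])

lemma BF_mult: "v \<in> carrier_vec m \<Longrightarrow> BF *\<^sub>v v \<in> carrier_vec p"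
  by (rule mult_mat_vec_carrier[OF BF])

lemma residual_mult:
  assumes w: "w \<in> carrier_vec p"
  shows "vnorm (transpose_mat BF *\<^sub>v w - AF *\<^sub>v (V1 *\<^sub>v w)) \<le> r1 * vnorm w"
proof -
  have AV: "AF * V1 \<in> carrier_mat m p" by (rule mult_carrier_mat[OF AF.M_carrier V1])
  have "transpose_mat BF *\<^sub>v w - AF *\<^sub>v (V1 *\<^sub>v w) = (transpose_mat BF - AF * V1) *\<^sub>v w"
    using minus_mult_distrib_mat_vec[OF BFt AV w] assoc_mult_mat_vec[OF AF.M_carrier V1 w] by simp
  then show ?thesis
    using vnorm_mult_mat_vec_le[OF minus_carrier_mat[OF AV] w, of "transpose_mat BF"]
    by (simp add: rho1_def)
qed

lemma v0_error: "lam_min A * vnorm (v0 - v0_ex A b F) \<le> r0"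
proof -
  have "AF *\<^sub>v (v0 - v0_ex A b F) = AF *\<^sub>v v0 - subvec b F"
    using mult_minus_distrib_mat_vec[OF AF.M_carrier v0 v0_ex(1)] by (simp add: v0_ex(2))
  then show ?thesis
    using AF_coercive[OF minus_carrier_vec[OF v0 v0_ex(1)]]
      vnorm_minus_commute[OF AF.mult_M_carrier[OF v0] subvec_carrier[OF b]]
    by (simp add: rho0_def)
qed

lemma V1_error:
  assumes w: "w \<in> carrier_vec p"
  shows "lam_min A * vnorm (V1 *\<^sub>v w - V1_ex A B F *\<^sub>v w) \<le> r1 * vnorm w"
proof -
  have "AF *\<^sub>v (V1 *\<^sub>v w - V1_ex A B F *\<^sub>v w) = AF *\<^sub>v (V1 *\<^sub>v w) - transpose_mat BF *\<^sub>v w"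
    using mult_minus_distrib_mat_vec[OF AF.M_carrier V1_mult[OF w] V1_ex_mult[OF w]]
    by (simp add: AF_V1_ex[OF w])
  then show ?thesis
    using AF_coercive[OF minus_carrier_vec[OF V1_mult[OF w] V1_ex_mult[OF w]]] residual_mult[OF w]
      vnorm_minus_commute[OF AF.mult_M_carrier[OF V1_mult[OF w]] BFt_mult[OF w]]
    by simp
qed

text \<open>Up to the residual, \<open>A\<^sub>F V\<^sub>1\<close> is the transpose of \<open>B\<^sub>F\<close>; coercivity does the rest.\<close>

lemma V1_bound:
  assumes w: "w \<in> carrier_vec p"
  shows "lam_min A * vnorm (V1 *\<^sub>v w) \<le> (spectral_norm BF + r1) * vnorm w"
proof -
  note AV = AF.mult_M_carrier[OF V1_mult[OF w]]
  have "lam_min A * vnorm (V1 *\<^sub>v w) \<le> vnorm (AF *\<^sub>v (V1 *\<^sub>v w))"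
    by (rule AF_coercive[OF V1_mult[OF w]])
  also have "\<dots> \<le> vnorm (transpose_mat BF *\<^sub>v w)
      + vnorm (transpose_mat BF *\<^sub>v w - AF *\<^sub>v (V1 *\<^sub>v w))"
    by (rule vnorm_diff_le[OF AV BFt_mult[OF w]])
  also have "\<dots> \<le> spectral_norm BF * vnorm w + r1 * vnorm w"
    by (intro add_mono vnorm_mult_transpose_le[OF BF w] residual_mult[OF w])
  finally show ?thesis by (simp add: algebra_simps)
qed

text \<open>If there is a constraint, then full row rank makes \<open>F\<close> nonempty. This separates the case where
  \<open>\<lambda>\<^sub>m\<^sub>i\<^sub>n(A)\<close> and \<open>\<lambda>\<^sub>m\<^sub>i\<^sub>n(S)\<close> are eigenvalues from the degenerate one, where the minimum of an empty
  spectrum is an unspecified number.\<close>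

lemma n_pos: "0 < p \<Longrightarrow> 0 < n"
proof (rule ccontr)
  assume p: "0 < p" and "\<not> 0 < n"
  then have "m = 0" using F_subset by simp
  let ?e = "unit_vec p 0 :: real vec"
  have "transpose_mat BF *\<^sub>v ?e = 0\<^sub>v m"
    using carrier_vecD[OF BFt_mult[of ?e]] \<open>m = 0\<close> by (intro eq_vecI) auto
  then have "?e = 0\<^sub>v p" by (rule BFt_injective[rotated]) simp
  then have "?e $ 0 = 0" using p by simp
  with p show False by simp
qed

lemma lam_min_A_pos: "0 < p \<Longrightarrow> 0 < lam_min A"
  using n_pos lam_min_pos by blast

lemma schur_error:
  assumes p: "0 < p" and w: "w \<in> carrier_vec p"
  shows "lam_min A * vnorm (schur B F V1 *\<^sub>v w - S *\<^sub>v w) \<le> spectral_norm BF * r1 * vnorm w"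
proof -
  note pos = lam_min_A_pos[OF p]
  let ?d = "V1 *\<^sub>v w - V1_ex A B F *\<^sub>v w"
  have d: "?d \<in> carrier_vec m" by (rule minus_carrier_vec[OF V1_mult[OF w] V1_ex_mult[OF w]])
  have "schur B F V1 *\<^sub>v w - S *\<^sub>v w = BF *\<^sub>v ?d"
    using mult_minus_distrib_mat_vec[OF BF V1_mult[OF w] V1_ex_mult[OF w]]
    by (simp add: S_ex_def schur_mult[OF V1 w] schur_mult[OF V1_ex w])
  then have "lam_min A * vnorm (schur B F V1 *\<^sub>v w - S *\<^sub>v w)
      \<le> lam_min A * (spectral_norm BF * vnorm ?d)"
    using vnorm_mult_mat_vec_le[OF BF d] pos by (intro mult_left_mono) auto
  also have "\<dots> \<le> spectral_norm BF * r1 * vnorm w"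
    using mult_left_mono[OF V1_error[OF w] spectral_norm_nonneg[of BF]] by (simp add: mult_ac)
  finally show ?thesis .
qed

lemma schur_V1_mult: "w \<in> carrier_vec p \<Longrightarrow> schur B F V1 *\<^sub>v w \<in> carrier_vec p"
  by (rule mult_mat_vec_carrier[OF schur_carrier[OF V1]])

text \<open>This is where the residual condition enters: it lets the perturbation of the Schur
  complement consume at most half of the lower bound for the exact one.\<close>

lemma schur_coercive:
  assumes p: "0 < p" and w: "w \<in> carrier_vec p"
  shows "lam_min S / 2 * vnorm w \<le> vnorm (schur B F V1 *\<^sub>v w)"
proof -
  note pos = lam_min_A_pos[OF p]
  let ?e = "vnorm (schur B F V1 *\<^sub>v w - S *\<^sub>v w)"
  have "lam_min S * vnorm w \<le> vnorm (S *\<^sub>v w)"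
    by (rule vnorm_geI[OF w S.mult_M_carrier[OF w] S.lam_min_le_form[OF w]])
  also have "\<dots> \<le> vnorm (schur B F V1 *\<^sub>v w) + ?e"
    by (rule vnorm_diff_le[OF S.mult_M_carrier[OF w] schur_V1_mult[OF w]])
  finally have 1: "lam_min S * vnorm w \<le> vnorm (schur B F V1 *\<^sub>v w) + ?e" .
  have "lam_min A * ?e \<le> (r1 * spectral_norm BF) * vnorm w"
    using schur_error[OF p w] by (simp add: mult_ac)
  also have "\<dots> \<le> (1 / 2 * lam_min A * lam_min S) * vnorm w"
    by (intro mult_right_mono star vnorm_nonneg)
  also have "\<dots> = lam_min A * (lam_min S / 2 * vnorm w)" by simp
  finally have "?e \<le> lam_min S / 2 * vnorm w" using pos by (simp only: mult_le_cancel_left_pos)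
  with 1 show ?thesis by simp
qed

lemma schur_injective:
  assumes w: "w \<in> carrier_vec p" "schur B F V1 *\<^sub>v w = 0\<^sub>v p"
  shows "w = 0\<^sub>v p"
proof (cases "p = 0")
  case True
  then show ?thesis using w(1) by (intro eq_vecI) auto
next
  case False
  then have "lam_min S / 2 * vnorm w \<le> 0" "0 < lam_min S"
    using schur_coercive[OF _ w(1)] w(2) S.lam_min_pos by auto
  then have "vnorm w = 0"
    using vnorm_nonneg[of w] by (simp add: mult_le_0_iff)
  then show ?thesis by (rule vnorm_eq_0D[OF w(1)])
qed

lemmas lam' = multiplier_solves[OF v0 V1 schur_injective]

lemma multiplier_error_le:
  "delta_lam A b B c F v0 V1 \<le> 2 * spectral_norm BF / (lam_min S * lam_min A) * (r0 + r1 * vnorm lam)"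
proof (cases "p = 0")
  \<comment> \<open>without constraints the denominator is unspecified, and the numerator vanishes\<close>
  case True
  have "delta_lam A b B c F v0 V1 = 0"
    unfolding delta_lam_def by (rule vnorm_dim_0) (use True lam'(1) lam(1) in auto)
  moreover have "spectral_norm BF \<le> 0"
  proof (rule spectral_norm_leI)
    fix v :: "real vec" assume "v \<in> carrier_vec (dim_col BF)"
    then have "BF *\<^sub>v v \<in> carrier_vec 0"
      using BF_mult[of v] True carrier_matD(2)[OF BF] by simp
    then show "vnorm (BF *\<^sub>v v) \<le> 0" by (simp add: vnorm_dim_0)
  qed
  then have "spectral_norm BF = 0" using spectral_norm_nonneg[of BF] by simp
  ultimately show ?thesis by simp
next
  case False
  then have p: "0 < p" by simp
  note posA = lam_min_A_pos[OF p] and posS = S.lam_min_pos[OF p]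
  let ?d = "lam' - lam" and ?e = "v0 - v0_ex A b F" and ?S' = "schur B F V1"
  let ?g = "?S' *\<^sub>v lam - S *\<^sub>v lam"
  have d: "?d \<in> carrier_vec p" by (rule minus_carrier_vec[OF lam'(1) lam(1)])
  have e: "?e \<in> carrier_vec m" by (rule minus_carrier_vec[OF v0 v0_ex(1)])
  have "?S' *\<^sub>v ?d = (c - BF *\<^sub>v v0) - ?S' *\<^sub>v lam"
    using mult_minus_distrib_mat_vec[OF schur_carrier[OF V1] lam'(1) lam(1)]
    by (simp only: lam'(2))
  also have "\<dots> = - ((BF *\<^sub>v v0 - BF *\<^sub>v v0_ex A b F) + (?S' *\<^sub>v lam - (c - BF *\<^sub>v v0_ex A b F)))"
    using c by (rule vec_residual_split[OF _ BF_mult[OF v0] BF_mult[OF v0_ex(1)]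
          schur_V1_mult[OF lam(1)]])
  also have "\<dots> = - (BF *\<^sub>v ?e + ?g)"
    by (simp only: lam(2) mult_minus_distrib_mat_vec[OF BF v0 v0_ex(1)])
  finally have "vnorm (?S' *\<^sub>v ?d) = vnorm (BF *\<^sub>v ?e + ?g)" by (simp only: vnorm_uminus)
  also have "\<dots> \<le> vnorm (BF *\<^sub>v ?e) + vnorm ?g"
    by (rule vnorm_triangle[OF BF_mult[OF e]
          minus_carrier_vec[OF schur_V1_mult[OF lam(1)] S.mult_M_carrier[OF lam(1)]]])
  finally have "lam_min A * vnorm (?S' *\<^sub>v ?d) \<le> lam_min A * (vnorm (BF *\<^sub>v ?e) + vnorm ?g)"
    using posA by (simp only: mult_le_cancel_left_pos)
  also have "\<dots> \<le> lam_min A * (spectral_norm BF * vnorm ?e) + lam_min A * vnorm ?g"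
    using mult_left_mono[OF vnorm_mult_mat_vec_le[OF BF e], of "lam_min A"] posA
    by (simp add: distrib_left)
  also have "lam_min A * (spectral_norm BF * vnorm ?e) \<le> spectral_norm BF * r0"
    using mult_left_mono[OF v0_error spectral_norm_nonneg[of BF]] by (simp add: mult_ac)
  also have "lam_min A * vnorm ?g \<le> spectral_norm BF * r1 * vnorm lam"
    by (rule schur_error[OF p lam(1)])
  finally have "lam_min A * vnorm (?S' *\<^sub>v ?d) \<le> spectral_norm BF * (r0 + r1 * vnorm lam)"
    by (simp add: algebra_simps)
  moreover have "lam_min A * (lam_min S / 2 * vnorm ?d) \<le> lam_min A * vnorm (?S' *\<^sub>v ?d)"
    using schur_coercive[OF p d] posA by (simp only: mult_le_cancel_left_pos)
  ultimately have "vnorm ?d * (lam_min S * lam_min A) \<le> 2 * spectral_norm BF * (r0 + r1 * vnorm lam)"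
    by (simp add: mult_ac)
  then have "vnorm ?d \<le> 2 * spectral_norm BF * (r0 + r1 * vnorm lam) / (lam_min S * lam_min A)"
    using posA posS by (simp only: pos_le_divide_eq mult_pos_pos)
  then show ?thesis by (simp add: delta_lam_def)
qed

lemma xF: "xF B c F v0 V1 = v0 + V1 *\<^sub>v lam'"
  by (simp add: xF_def)

lemma xF_carrier: "xF B c F v0 V1 \<in> carrier_vec m"
  unfolding xF using v0 V1_mult[OF lam'(1)] by simp

lemma x_error_le:
  "delta_x A b B c F v0 V1 \<le> (r0 + r1 * vnorm lam) / lam_min A
     + (spectral_norm BF + r1) / lam_min A * delta_lam A b B c F v0 V1"
proof (cases "n = 0")
  case True
  then have m: "m = 0" using F_subset by simp
  have p: "p = 0" using n_pos True by auto
  have "delta_x A b B c F v0 V1 = 0"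
    unfolding delta_x_def by (rule vnorm_dim_0) (use m xF_carrier xF_ex_carrier in auto)
  moreover have "r0 = 0"
    unfolding rho0_def
    by (rule vnorm_dim_0) (use m subvec_carrier[OF b] AF.mult_M_carrier[OF v0] in auto)
  moreover have "delta_lam A b B c F v0 V1 = 0"
    unfolding delta_lam_def by (rule vnorm_dim_0) (use p lam'(1) lam(1) in auto)
  moreover have "vnorm lam = 0" by (rule vnorm_dim_0) (use p lam(1) in auto)
  ultimately show ?thesis by simp
next
  case False
  then have pos: "0 < lam_min A" by (simp add: lam_min_pos)
  let ?d = "lam' - lam" and ?V = "V1_ex A B F"
  have d: "?d \<in> carrier_vec p" by (rule minus_carrier_vec[OF lam'(1) lam(1)])
  note Vd = V1_mult[OF lam(1)] V1_ex_mult[OF lam(1)] V1_mult[OF lam'(1)]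
  have "xF B c F v0 V1 - xF_ex A b B c F = (v0 - v0_ex A b F)
      + ((V1 *\<^sub>v lam - ?V *\<^sub>v lam) + (V1 *\<^sub>v lam' - V1 *\<^sub>v lam))"
    unfolding xF xF_ex by (rule vec_diff_split[OF v0 v0_ex(1) Vd(3,2,1)])
  also have "\<dots> = (v0 - v0_ex A b F) + ((V1 *\<^sub>v lam - ?V *\<^sub>v lam) + V1 *\<^sub>v ?d)"
    by (simp only: mult_minus_distrib_mat_vec[OF V1 lam'(1) lam(1)])
  finally have "delta_x A b B c F v0 V1
      \<le> vnorm (v0 - v0_ex A b F) + vnorm ((V1 *\<^sub>v lam - ?V *\<^sub>v lam) + V1 *\<^sub>v ?d)"
    unfolding delta_x_def
    by (simp only: vnorm_triangle[OF minus_carrier_vec[OF v0 v0_ex(1)]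
          add_carrier_vec[OF minus_carrier_vec[OF Vd(1,2)] V1_mult[OF d]]])
  also have "\<dots> \<le> vnorm (v0 - v0_ex A b F)
      + (vnorm (V1 *\<^sub>v lam - ?V *\<^sub>v lam) + vnorm (V1 *\<^sub>v ?d))"
    by (intro add_left_mono vnorm_triangle[OF minus_carrier_vec[OF Vd(1,2)] V1_mult[OF d]])
  finally have "lam_min A * delta_x A b B c F v0 V1 \<le> lam_min A * \<dots>"
    using pos by (simp only: mult_le_cancel_left_pos)
  also have "\<dots> \<le> r0 + r1 * vnorm lam + (spectral_norm BF + r1) * vnorm ?d"
    using v0_error V1_error[OF lam(1)] V1_bound[OF d] by (simp only: distrib_left)
  finally have "delta_x A b B c F v0 V1
      \<le> (r0 + r1 * vnorm lam + (spectral_norm BF + r1) * vnorm ?d) / lam_min A"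
    using pos by (simp add: pos_le_divide_eq mult.commute)
  then show ?thesis by (simp add: delta_lam_def add_divide_distrib distrib_right)
qed

lemma redgrad_error:
  assumes i: "i < n"
  shows "\<bar>redgrad A b B c F v0 V1 $ i - s_ex A b B c F $ i\<bar>
    \<le> lam_max A * delta_x A b B c F v0 V1 + spectral_norm B * delta_lam A b B c F v0 V1"
proof -
  let ?x = "zext n F (xF B c F v0 V1)" and ?y = "zext n F (xF_ex A b B c F)"
  let ?Bt = "transpose_mat B"
  have Bt: "?Bt \<in> carrier_mat n p" using B by simp
  have xy: "?x - ?y = zext n F (xF B c F v0 V1 - xF_ex A b B c F)"
    by (rule zext_minus[OF xF_carrier xF_ex_carrier])
  have d: "lam' - lam \<in> carrier_vec p" by (rule minus_carrier_vec[OF lam'(1) lam(1)])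
  have dc: "?x - ?y \<in> carrier_vec n" by (rule minus_carrier_vec[OF zext_carrier zext_carrier])
  have "redgrad A b B c F v0 V1 $ i - s_ex A b B c F $ i
      = ((A *\<^sub>v ?x - b - ?Bt *\<^sub>v lam') - (A *\<^sub>v ?y - b - ?Bt *\<^sub>v lam)) $ i"
    using i Bt_mult[OF lam(1)] by (simp add: redgrad_def xfull_def s_ex x_ex dim_B)
  also have "\<dots> = ((A *\<^sub>v ?x - A *\<^sub>v ?y) - (?Bt *\<^sub>v lam' - ?Bt *\<^sub>v lam)) $ i"
    by (simp only: gradient_diff[OF mult_M_carrier[OF zext_carrier] mult_M_carrier[OF zext_carrier] b
          Bt_mult[OF lam'(1)] Bt_mult[OF lam(1)]])
  also have "\<dots> = (A *\<^sub>v (?x - ?y) - ?Bt *\<^sub>v (lam' - lam)) $ i"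
    by (simp only: mult_minus_distrib_mat_vec[OF M_carrier zext_carrier zext_carrier]
        mult_minus_distrib_mat_vec[OF Bt lam'(1) lam(1)])
  also have "\<dots> = (A *\<^sub>v (?x - ?y)) $ i - (?Bt *\<^sub>v (lam' - lam)) $ i"
    using i carrier_vecD[OF Bt_mult[OF d]] by (simp del: index_mult_mat_vec)
  finally have "\<bar>redgrad A b B c F v0 V1 $ i - s_ex A b B c F $ i\<bar>
      \<le> \<bar>(A *\<^sub>v (?x - ?y)) $ i\<bar> + \<bar>(?Bt *\<^sub>v (lam' - lam)) $ i\<bar>"
    by (simp only: abs_triangle_ineq4)
  also have "\<dots> \<le> vnorm (A *\<^sub>v (?x - ?y)) + vnorm (?Bt *\<^sub>v (lam' - lam))"
    by (intro add_mono abs_index_le_vnorm)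
      (simp_all only: i carrier_vecD[OF mult_M_carrier[OF dc]] carrier_vecD[OF Bt_mult[OF d]])
  also have "\<dots> \<le> lam_max A * vnorm (?x - ?y) + spectral_norm B * vnorm (lam' - lam)"
    by (intro add_mono vnorm_mult_le[OF dc] vnorm_mult_transpose_le[OF B d])
  also have "vnorm (?x - ?y) = delta_x A b B c F v0 V1"
    unfolding xy delta_x_def by (rule vnorm_zext[OF minus_carrier_vec[OF xF_carrier xF_ex_carrier]])
  finally show ?thesis by (simp add: delta_lam_def)
qed

lemma delta_s_set_finite:
  "finite (insert 0 {\<bar>redgrad A b B c F v0 V1 $ i - s_ex A b B c F $ i\<bar> | i. i < n \<and> i \<notin> F})"
  by simp

lemma s_error_le:
  "delta_s A b B c F v0 V1
    \<le> lam_max A * delta_x A b B c F v0 V1 + spectral_norm B * delta_lam A b B c F v0 V1"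
proof -
  have nonneg: "0 \<le> lam_max A * delta_x A b B c F v0 V1" if "0 < n"
    using lam_max_nonneg[OF that] by (simp add: delta_x_def)
  have zero: "delta_x A b B c F v0 V1 = 0" if "n = 0"
    unfolding delta_x_def
    by (rule vnorm_dim_0) (use that F_subset xF_carrier xF_ex_carrier in auto)
  have "0 \<le> lam_max A * delta_x A b B c F v0 V1 + spectral_norm B * delta_lam A b B c F v0 V1"
    using nonneg zero spectral_norm_nonneg[of B] by (cases "n = 0") (auto simp: delta_lam_def)
  then show ?thesis
    unfolding delta_s_def dim_M using delta_s_set_finite redgrad_error by (subst Max_le_iff) auto
qed

lemma xfull_error:
  assumes "i \<in> F"
  shows "\<bar>xfull n B c F v0 V1 $ i - x_ex A b B c F $ i\<bar> \<le> delta_x A b B c F v0 V1"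
proof -
  obtain k where k: "k < m" "i = pick F k" using assms by (rule obtain_pick)
  then show ?thesis
    using abs_index_le_vnorm[of k "xF B c F v0 V1 - xF_ex A b B c F"]
      carrier_vecD[OF xF_ex_carrier]
    by (simp add: xfull_def x_ex delta_x_def)
qed

lemma redgrad_error_delta_s:
  assumes "i < n" "i \<notin> F"
  shows "\<bar>redgrad A b B c F v0 V1 $ i - s_ex A b B c F $ i\<bar> \<le> delta_s A b B c F v0 V1"
  unfolding delta_s_def dim_M using assms by (intro Max_ge delta_s_set_finite) auto

end

section \<open>Least-index pivoting\<close>

text \<open>The monotonicity assumption is contradicted by two consecutive pivots on the greatest index \<open>K\<close> that
  recurs forever: each product of the sum is nonpositive at the indices below \<open>K\<close>, where all entries
  are nonnegative and complementary, vanishes above \<open>K\<close>, where the status did not change, and is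
  negative at \<open>K\<close>, which is violated on one side at the first time and on the other side at the
  second.\<close>

lemma no_infinite_least_index_pivoting:
  fixes F :: "nat \<Rightarrow> nat set" and x s :: "nat \<Rightarrow> nat \<Rightarrow> real" and k :: "nat \<Rightarrow> nat"
  assumes s_zero: "\<And>t i. \<lbrakk>i < n; i \<in> F t\<rbrakk> \<Longrightarrow> s t i = 0"
    and x_zero: "\<And>t i. \<lbrakk>i < n; i \<notin> F t\<rbrakk> \<Longrightarrow> x t i = 0"
    and monotone: "\<And>t u. 0 \<le> (\<Sum>i\<in>{0..<n}. (x t i - x u i) * (s t i - s u i))"
    and k_less: "\<And>t. k t < n"
    and x_viol: "\<And>t. k t \<in> F t \<Longrightarrow> x t (k t) < 0"
    and s_viol: "\<And>t. k t \<notin> F t \<Longrightarrow> s t (k t) < 0"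
    and x_below: "\<And>t i. \<lbrakk>i < k t; i \<in> F t\<rbrakk> \<Longrightarrow> 0 \<le> x t i"
    and s_below: "\<And>t i. \<lbrakk>i < k t; i \<notin> F t\<rbrakk> \<Longrightarrow> 0 \<le> s t i"
    and pivot: "\<And>t. F (Suc t) = (if k t \<in> F t then F t - {k t} else F t \<union> {k t})"
  shows False
proof -
  let ?P = "\<lambda>K. \<exists>t0. \<forall>t\<ge>t0. k t \<le> K"
  \<comment> \<open>the limit superior of the pivot indices\<close>
  define K where "K = (LEAST K. ?P K)"
  have "?P n" using k_less less_imp_le by blast
  then have "?P K" unfolding K_def by (rule LeastI)
  then obtain t0 where t0: "\<And>t. t0 \<le> t \<Longrightarrow> k t \<le> K" by blast
  have recur: "\<exists>u\<ge>t. k u = K" for t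
  proof (rule ccontr)
    assume "\<not> (\<exists>u\<ge>t. k u = K)"
    then have less: "k u < K" if "max t t0 \<le> u" for u
      using t0[of u] that by (metis le_neq_implies_less max.bounded_iff)
    then have "?P (K - 1)" by (intro exI[of _ "max t t0"]) fastforce
    moreover have "K - 1 < K" using less[of "max t t0"] by simp
    ultimately show False using not_less_Least[of "K - 1" ?P] unfolding K_def by blast
  qed
  obtain t where t: "t0 \<le> t" "k t = K" using recur by blast
  define u where "u = (LEAST u. Suc t \<le> u \<and> k u = K)"
  have u: "Suc t \<le> u" "k u = K"
    using LeastI_ex[of "\<lambda>u. Suc t \<le> u \<and> k u = K"] recur[of "Suc t"] by (auto simp: u_def)
  have between: "k v < K" if "t < v" "v < u" for v
    using not_less_Least[of v "\<lambda>u. Suc t \<le> u \<and> k u = K"] t0[of v] t(1) that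
    by (fastforce simp: u_def)
  have "(\<forall>i>K. i \<in> F v \<longleftrightarrow> i \<in> F t) \<and> (K \<in> F v \<longleftrightarrow> K \<notin> F t)" if "Suc t \<le> v" "v \<le> u" for v
    using that
  proof (induction v rule: dec_induct)
    case base
    then show ?case using pivot[of t] t(2) by auto
  next
    case (step v)
    then have "k v < K" by (intro between) auto
    with step show ?case using pivot[of v] by auto
  qed
  from this[OF u(1) order_refl]
  have above: "\<And>i. K < i \<Longrightarrow> i \<in> F u \<longleftrightarrow> i \<in> F t" and flip: "K \<in> F u \<longleftrightarrow> K \<notin> F t" by auto
  let ?f = "\<lambda>i. (x t i - x u i) * (s t i - s u i)"
  have nonpos: "?f i \<le> 0" if i: "i < n" "i \<noteq> K" for i
  proof (cases "K < i")
    case True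
    then show ?thesis using above s_zero x_zero i(1) by (cases "i \<in> F t") auto
  next
    case False
    with i have less: "i < k t" "i < k u" using t u by auto
    have tt: "0 \<le> x t i \<and> 0 \<le> s t i" using less x_below s_below s_zero x_zero i(1) by (metis order_refl)
    have uu: "0 \<le> x u i \<and> 0 \<le> s u i" using less x_below s_below s_zero x_zero i(1) by (metis order_refl)
    have prod: "x t i * s t i = 0" "x u i * s u i = 0"
      using s_zero x_zero i(1) by (metis mult_zero_left mult_zero_right)+
    have "?f i = x t i * s t i + x u i * s u i - x t i * s u i - x u i * s t i"
      by (simp add: algebra_simps)
    then show ?thesis using prod tt uu mult_nonneg_nonneg[of "x t i" "s u i"]
        mult_nonneg_nonneg[of "x u i" "s t i"] by linarith
  qed
  have K: "K < n" using k_less[of t] t(2) by simp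
  have "?f K < 0"
  proof (cases "K \<in> F t")
    case True
    then have "x t K < 0" "s t K = 0" "x u K = 0" "s u K < 0"
      using x_viol[of t] s_viol[of u] s_zero x_zero K flip t(2) u(2) by auto
    then show ?thesis by (simp add: mult_neg_neg)
  next
    case False
    then have "x t K = 0" "s t K < 0" "x u K < 0" "s u K = 0"
      using x_viol[of u] s_viol[of t] s_zero x_zero K flip t(2) u(2) by auto
    then show ?thesis by (simp add: mult_neg_neg)
  qed
  then have "(\<Sum>i\<in>{0..<n}. ?f i) < (\<Sum>i\<in>{0..<n}. 0)"
  proof (intro sum_strict_mono_ex1 ballI)
    show "?f i \<le> 0" if "i \<in> {0..<n}" for i
      using nonpos[of i] \<open>?f K < 0\<close> that by (cases "i = K") auto
    show "\<exists>i\<in>{0..<n}. ?f i < 0" using K \<open>?f K < 0\<close> by (intro bexI[of _ K]) auto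
  qed simp
  with monotone[of t u] show False by simp
qed

section \<open>The guarded loop\<close>

lemma violators_subset:
  assumes "F \<subseteq> {0..<n}"
  shows "free_viol eps F x \<union> bound_viol n eps F s \<subseteq> {0..<n}"
    "finite (free_viol eps F x \<union> bound_viol n eps F s)"
proof -
  show *: "free_viol eps F x \<union> bound_viol n eps F s \<subseteq> {0..<n}"
    using assms by (auto simp: free_viol_def bound_viol_def)
  show "finite (free_viol eps F x \<union> bound_viol n eps F s)"
    using finite_subset[OF *] by simp
qed

text \<open>A step either decreases \<open>(N, q)\<close> lexicographically or is a single pivot on the least violated
  index; resetting \<open>q\<close> is paid for by the decrease of \<open>N\<close>.\<close>

lemma loop_step_cases:
  assumes F: "F \<subseteq> {0..<n}"
    and step: "loop_step n pmax eps (x, s) (F, N, q) = Some (F', N', q')"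
  defines "W \<equiv> free_viol eps F x \<union> bound_viol n eps F s"
  shows "W \<noteq> {}"
    and "N' < N \<or> N' = N \<and> q' < q \<or>
      N' = N \<and> q' = q \<and> F' = (if Min W \<in> F then F - {Min W} else F \<union> {Min W})"
    and "F' \<subseteq> {0..<n}"
proof -
  have W: "W \<subseteq> {0..<n}" "finite W" unfolding W_def by (rule violators_subset[OF F])+
  show ne: "W \<noteq> {}" using step by (auto simp: loop_step_def W_def Let_def)
  have Min: "Min W \<in> W" by (rule Min_in[OF W(2) ne])
  then have D: "Min W \<in> free_viol eps F x \<longleftrightarrow> Min W \<in> F"
    unfolding W_def by (auto simp: free_viol_def bound_viol_def)
  have nz: "card W \<noteq> 0" using W(2) ne by simp
  then have *: "(if card W < N then Some ((F - free_viol eps F x) \<union> bound_viol n eps F s, card W, pmax)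
      else if q > 0 then Some ((F - free_viol eps F x) \<union> bound_viol n eps F s, N, q - 1)
      else if Min W \<in> F then Some (F - {Min W}, N, q)
      else Some (F \<union> {Min W}, N, q)) = Some (F', N', q')"
    using step unfolding W_def loop_step_def Let_def prod.case
    by (simp only: nz[unfolded W_def] D[unfolded W_def] if_False)
  show "N' < N \<or> N' = N \<and> q' < q \<or>
      N' = N \<and> q' = q \<and> F' = (if Min W \<in> F then F - {Min W} else F \<union> {Min W})"
    using * by (auto split: if_splits)
  show "F' \<subseteq> {0..<n}"
    using * F W(1) Min by (auto simp: W_def split: if_splits)
qed

lemma loop_at_subset:
  "loop_at n pmax eps solve t = Some (F, N, q) \<Longrightarrow> F \<subseteq> {0..<n}"
proof (induction t arbitrary: F N q)
  case (Suc t)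
  then obtain G M r where G: "loop_at n pmax eps solve t = Some (G, M, r)"
    "loop_step n pmax eps (solve t G) (G, M, r) = Some (F, N, q)"
    by (auto simp: bind_eq_Some_conv)
  show ?case
    using loop_step_cases(3)[OF Suc.IH[OF G(1)]] G(2) by (metis prod.collapse)
qed simp

lemma loop_at_None_mono:
  "\<lbrakk>loop_at n pmax eps solve t = None; t \<le> u\<rbrakk> \<Longrightarrow> loop_at n pmax eps solve u = None"
  by (induction u) (auto simp: le_Suc_eq)

text \<open>Along the loop the pair of \<open>N\<close> and \<open>q\<close> never increases lexicographically, so that an
  infinite run eventually keeps it fixed and hence consists of single least-index pivots only.\<close>

lemma infinite_loop_pivots:
  assumes inf: "\<And>t. loop_at n pmax eps solve t \<noteq> None"
  obtains t0 G where "\<And>t. \<exists>N q. loop_at n pmax eps solve (t0 + t) = Some (G t, N, q)"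
    "\<And>t. let W = free_viol eps (G t) (fst (solve (t0 + t) (G t)))
            \<union> bound_viol n eps (G t) (snd (solve (t0 + t) (G t)))
      in W \<noteq> {} \<and> G (Suc t) = (if Min W \<in> G t then G t - {Min W} else G t \<union> {Min W})"
proof -
  define F where "F = (\<lambda>t. fst (the (loop_at n pmax eps solve t)))"
  define Nq where "Nq = (\<lambda>t. snd (the (loop_at n pmax eps solve t)))"
  have st: "loop_at n pmax eps solve t = Some (F t, fst (Nq t), snd (Nq t))" for t
    using inf[of t] by (auto simp: F_def Nq_def)
  have step: "loop_step n pmax eps (fst (solve t (F t)), snd (solve t (F t))) (F t, fst (Nq t), snd (Nq t))
      = Some (F (Suc t), fst (Nq (Suc t)), snd (Nq (Suc t)))" for t
    using st[of "Suc t"] by (simp add: st[of t] del: loop_at.simps(1))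
  note cases = loop_step_cases[OF loop_at_subset[OF st] step]
  let ?R = "less_than <*lex*> less_than"
  obtain z where z: "z \<in> range Nq" "\<And>y. (y, z) \<in> ?R \<Longrightarrow> y \<notin> range Nq"
    using wfE_min[of ?R "Nq 0" "range Nq"] by (metis rangeI wf_less_than wf_lex_prod)
  then obtain t0 where t0: "z = Nq t0" by blast
  have const: "Nq (t0 + t) = z" for t
  proof (induction t)
    case (Suc t)
    have "Nq (Suc (t0 + t)) = Nq (t0 + t) \<or> (Nq (Suc (t0 + t)), Nq (t0 + t)) \<in> ?R"
      using cases(2)[of "t0 + t"]
      by (cases "Nq (Suc (t0 + t))"; cases "Nq (t0 + t)") (auto simp: in_lex_prod)
    then show ?case using z(2) Suc by (metis add_Suc_right rangeI)
  qed (simp add: t0)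
  show thesis
  proof (rule that[of t0 "\<lambda>t. F (t0 + t)"])
    fix t
    show "\<exists>N q. loop_at n pmax eps solve (t0 + t) = Some (F (t0 + t), N, q)" using st by blast
    have "Nq (Suc (t0 + t)) = Nq (t0 + t)" using const[of t] const[of "Suc t"] by simp
    then show "let W = free_viol eps (F (t0 + t)) (fst (solve (t0 + t) (F (t0 + t))))
            \<union> bound_viol n eps (F (t0 + t)) (snd (solve (t0 + t) (F (t0 + t))))
      in W \<noteq> {} \<and> F (t0 + Suc t)
        = (if Min W \<in> F (t0 + t) then F (t0 + t) - {Min W} else F (t0 + t) \<union> {Min W})"
      using cases(1,2)[of "t0 + t"] by (simp add: Let_def)
  qed
qed

lemma finite_loop_last_step:
  assumes "loop_at n pmax eps solve t = None"
  obtains T st where "\<forall>t\<le>T. loop_at n pmax eps solve t \<noteq> None"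
    "\<forall>t>T. loop_at n pmax eps solve t = None"
    "loop_at n pmax eps solve T = Some st"
    "loop_step n pmax eps (solve T (fst st)) st = None"
proof -
  define u where "u = (LEAST t. loop_at n pmax eps solve t = None)"
  have u: "loop_at n pmax eps solve u = None" unfolding u_def by (rule LeastI[of _ t]) (rule assms)
  have below: "loop_at n pmax eps solve v \<noteq> None" if "v < u" for v
    using not_less_Least that unfolding u_def by blast
  obtain T where T: "u = Suc T" using u by (cases u) auto
  obtain st where st: "loop_at n pmax eps solve T = Some st" using below[of T] T by auto
  show thesis
  proof (rule that[of T st])
    show "\<forall>t\<le>T. loop_at n pmax eps solve t \<noteq> None" using below T by auto
    show "\<forall>t>T. loop_at n pmax eps solve t = None" using loop_at_None_mono[OF u] T by auto
    show "loop_step n pmax eps (solve T (fst st)) st = None" using u st T by auto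
  qed (rule st)
qed

lemma loop_step_None_iff:
  assumes "F \<subseteq> {0..<n}"
  shows "loop_step n pmax eps (x, s) (F, N, q) = None \<longleftrightarrow>
    free_viol eps F x = {} \<and> bound_viol n eps F s = {}"
  using violators_subset(2)[OF assms, of eps x s] by (auto simp: loop_step_def Let_def)

text \<open>A negative exact value lies more than \<open>d\<close> below \<open>- eps\<close> and is not lifted across it; a
  nonnegative one lies \<open>eps > d\<close> or more above and is not pushed across it.\<close>

lemma sign_test_stable:
  fixes x y d eps :: real
  assumes "\<bar>y - x\<bar> \<le> d" "d < eps" "x \<noteq> 0 \<Longrightarrow> d < \<bar>x\<bar> - eps"
  shows "y < - eps \<longleftrightarrow> x < 0"
  using assms by (cases "x = 0") auto

section \<open>Monotonicity and optimality of the exact solves\<close>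

context eq_qp
begin

text \<open>The difference of two feasible points is orthogonal to the range of the transpose of
  \<open>B\<close>, so that only the positive definite part of the difference of the gradients remains.\<close>

lemma exact_solves_monotone:
  assumes F: "free_set_solve n p A B b c F" and G: "free_set_solve n p A B b c G"
  shows "0 \<le> (\<Sum>i\<in>{0..<n}. (x_ex A b B c F $ i - x_ex A b B c G $ i)
                        * (s_ex A b B c F $ i - s_ex A b B c G $ i))"
proof -
  interpret F: free_set_solve n p A B b c F by (rule F)
  interpret G: free_set_solve n p A B b c G by (rule G)
  let ?x = "x_ex A b B c F" and ?y = "x_ex A b B c G"
  let ?s = "s_ex A b B c F" and ?t = "s_ex A b B c G"
  let ?Bt = "transpose_mat B" and ?d = "?x - ?y" and ?l = "F.lam - G.lam"
  have Bt: "?Bt \<in> carrier_mat n p" using B by simp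
  have d: "?d \<in> carrier_vec n" by (rule minus_carrier_vec[OF F.x_ex_carrier G.x_ex_carrier])
  have l: "?l \<in> carrier_vec p" by (rule minus_carrier_vec[OF F.lam(1) G.lam(1)])
  have Bd: "B *\<^sub>v ?d = 0\<^sub>v p"
    using mult_minus_distrib_mat_vec[OF B F.x_ex_carrier G.x_ex_carrier] c
    by (simp add: F.B_x_ex G.B_x_ex)
  have "?s - ?t = (A *\<^sub>v ?x - A *\<^sub>v ?y) - (?Bt *\<^sub>v F.lam - ?Bt *\<^sub>v G.lam)"
    unfolding F.s_ex G.s_ex
    by (rule gradient_diff[OF mult_M_carrier[OF F.x_ex_carrier] mult_M_carrier[OF G.x_ex_carrier] b
          F.Bt_mult[OF F.lam(1)] F.Bt_mult[OF G.lam(1)]])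
  also have "\<dots> = A *\<^sub>v ?d - ?Bt *\<^sub>v ?l"
    by (simp only: mult_minus_distrib_mat_vec[OF M_carrier F.x_ex_carrier G.x_ex_carrier]
        mult_minus_distrib_mat_vec[OF Bt F.lam(1) G.lam(1)])
  finally have "?d \<bullet> (?s - ?t) = ?d \<bullet> (A *\<^sub>v ?d) - ?d \<bullet> (?Bt *\<^sub>v ?l)"
    by (simp only: scalar_prod_minus_distrib[OF d mult_M_carrier[OF d] F.Bt_mult[OF l]])
  also have "?d \<bullet> (?Bt *\<^sub>v ?l) = 0"
    using transpose_vec_mult_scalar[OF B d l] comm_scalar_prod[OF d F.Bt_mult[OF l]] l
    by (simp add: Bd)
  finally have "0 \<le> ?d \<bullet> (?s - ?t)" using form_nonneg[OF d] by simp
  also have "?d \<bullet> (?s - ?t) = (\<Sum>i\<in>{0..<n}. (?x $ i - ?y $ i) * (?s $ i - ?t $ i))"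
    using F.x_ex_carrier G.x_ex_carrier F.s_ex_carrier G.s_ex_carrier by (simp add: scalar_prod_def)
  finally show ?thesis .
qed

text \<open>Sufficiency of the Karush-Kuhn-Tucker conditions: in the expansion of the objective
  around \<open>x\<close>, the linear term at a feasible point is the scalar product with the nonnegative
  reduced gradient, and the quadratic term is strictly positive.\<close>

lemma exact_solve_unique_minimiser:
  assumes F: "free_set_solve n p A B b c F"
    and x_nonneg: "\<And>i. i < n \<Longrightarrow> 0 \<le> x_ex A b B c F $ i"
    and s_nonneg: "\<And>i. i < n \<Longrightarrow> 0 \<le> s_ex A b B c F $ i"
  shows "unique_minimiser A b B c (x_ex A b B c F)"
proof -
  interpret F: free_set_solve n p A B b c F by (rule F)
  let ?x = "x_ex A b B c F" and ?s = "s_ex A b B c F" and ?z = "transpose_mat B *\<^sub>v F.lam"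
  note x = F.x_ex_carrier and s = F.s_ex_carrier and z = F.Bt_mult[OF F.lam(1)]
  have feas: "feasible n B c ?x"
    using x x_nonneg by (simp add: feasible_def F.B_x_ex)
  have less: "objective A b ?x < objective A b y" if y: "feasible n B c y" "y \<noteq> ?x" for y
  proof -
    have yc: "y \<in> carrier_vec n" and By: "B *\<^sub>v y = c" and y_nonneg: "\<And>i. i < n \<Longrightarrow> 0 \<le> y $ i"
      using y(1) by (auto simp: feasible_def)
    let ?d = "y - ?x"
    have d: "?d \<in> carrier_vec n" by (rule minus_carrier_vec[OF yc x])
    have "?d \<noteq> 0\<^sub>v n"
    proof
      assume "?d = 0\<^sub>v n"
      then have "y = ?x" using vec_add_diff[OF x yc] x by simp
      with y(2) show False by simp
    qed
    then have pos: "0 < ?d \<bullet> (A *\<^sub>v ?d)" by (rule form_pos[OF d])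
    have yx: "y = ?x + 1 \<cdot>\<^sub>v ?d" using x yc by (intro eq_vecI) auto
    have Bd: "B *\<^sub>v ?d = 0\<^sub>v p"
      using mult_minus_distrib_mat_vec[OF B yc x] c by (simp add: F.B_x_ex By)
    have Axd: "?x \<bullet> (A *\<^sub>v ?d) = (A *\<^sub>v ?x) \<bullet> ?d"
      using form_commute[OF x d] comm_scalar_prod[OF d mult_M_carrier[OF x]] by simp
    have "A *\<^sub>v ?x = ?s + (b + ?z)"
      unfolding F.s_ex using mult_M_carrier[OF x] b z by (rule vec_minus_minus_add)
    then have "(A *\<^sub>v ?x) \<bullet> ?d = ?s \<bullet> ?d + (b \<bullet> ?d + ?z \<bullet> ?d)"
      using add_scalar_prod_distrib[OF s add_carrier_vec[OF b z] d] add_scalar_prod_distrib[OF b z d]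
      by simp
    moreover have "?z \<bullet> ?d = 0"
      using transpose_vec_mult_scalar[OF B d F.lam(1)] F.lam(1) by (simp add: Bd)
    moreover have "0 \<le> ?s \<bullet> ?d"
    proof -
      have "0 \<le> ?s $ i * (y $ i - ?x $ i)" if i: "i < n" for i
      proof -
        have "?s $ i = 0 \<or> ?x $ i = 0" using F.s_ex_zero F.x_ex_zero i by blast
        then show ?thesis using s_nonneg[OF i] y_nonneg[OF i] by auto
      qed
      then show ?thesis using x yc by (auto simp: scalar_prod_def intro!: sum_nonneg)
    qed
    ultimately have "b \<bullet> ?d \<le> ?x \<bullet> (A *\<^sub>v ?d)" using Axd by simp
    moreover have "y \<bullet> (A *\<^sub>v y) = ?x \<bullet> (A *\<^sub>v ?x) + 2 * (?x \<bullet> (A *\<^sub>v ?d)) + ?d \<bullet> (A *\<^sub>v ?d)"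
      using form_add_smult[OF x d, of 1] unfolding yx[symmetric] by simp
    moreover have "b \<bullet> y = b \<bullet> ?x + b \<bullet> ?d"
      using scalar_prod_minus_distrib[OF b yc x] by simp
    ultimately show ?thesis using pos unfolding objective_def by linarith
  qed
  have "is_arg_min (objective A b) (feasible n B c) ?x"
    unfolding is_arg_min_def using feas less by (metis less_asym less_irrefl)
  moreover have "y = ?x" if "is_arg_min (objective A b) (feasible n B c) y" for y
    using that less[of y] feas unfolding is_arg_min_def by blast
  ultimately show ?thesis unfolding unique_minimiser_def dim_M by blast
qed

section \<open>Termination of the exact loop\<close>

abbreviation exact_solver :: "nat \<Rightarrow> nat set \<Rightarrow> real vec \<times> real vec" where
  "exact_solver \<equiv> \<lambda>_ F. (x_ex A b B c F, s_ex A b B c F)"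

lemma exact_loop_terminates:
  assumes rank: "\<And>t F. exact_visit pmax A b B c t = Some F \<Longrightarrow> full_row_rank (csub B F)"
  shows "\<exists>t. loop_at n pmax 0 exact_solver t = None"
proof (rule ccontr)
  assume "\<not> ?thesis"
  then have inf: "\<And>t. loop_at n pmax 0 exact_solver t \<noteq> None" by simp
  obtain t0 G where
      G: "\<And>t. \<exists>N q. loop_at n pmax 0 exact_solver (t0 + t) = Some (G t, N, q)"
    and piv: "\<And>t. let W = free_viol 0 (G t) (fst (exact_solver (t0 + t) (G t)))
              \<union> bound_viol n 0 (G t) (snd (exact_solver (t0 + t) (G t)))
        in W \<noteq> {} \<and> G (Suc t) = (if Min W \<in> G t then G t - {Min W} else G t \<union> {Min W})"
    using infinite_loop_pivots[OF inf] by blast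
  define W where "W = (\<lambda>t. free_viol 0 (G t) (x_ex A b B c (G t))
    \<union> bound_viol n 0 (G t) (s_ex A b B c (G t)))"
  have W_ne: "W t \<noteq> {}"
    and step: "G (Suc t) = (if Min (W t) \<in> G t then G t - {Min (W t)} else G t \<union> {Min (W t)})" for t
    using piv[of t] by (simp_all add: W_def Let_def)
  have sub: "G t \<subseteq> {0..<n}" for t using G[of t] loop_at_subset by blast
  have "full_row_rank (csub B (G t))" for t
    using G[of t] by (intro rank[of "t0 + t"]) (auto simp: exact_visit_def)
  then have solve: "free_set_solve n p A B b c (G t)" for t
    using sub by unfold_locales auto
  have W: "W t \<subseteq> {0..<n}" "finite (W t)" for t
    unfolding W_def by (rule violators_subset[OF sub])+
  have Min: "Min (W t) \<in> W t" for t by (rule Min_in[OF W(2) W_ne])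
  have below: "i \<notin> W t" if "i < Min (W t)" for i t
    using Min_le[OF W(2), of i t] that by auto
  show False
  proof (rule no_infinite_least_index_pivoting[of n G "\<lambda>t i. s_ex A b B c (G t) $ i"
        "\<lambda>t i. x_ex A b B c (G t) $ i" "\<lambda>t. Min (W t)"])
    show "s_ex A b B c (G t) $ i = 0" if "i \<in> G t" for t i
      by (rule free_set_solve.s_ex_zero[OF solve that])
    show "x_ex A b B c (G t) $ i = 0" if "i < n" "i \<notin> G t" for t i
      by (rule free_set_solve.x_ex_zero[OF solve that])
    show "0 \<le> (\<Sum>i\<in>{0..<n}. (x_ex A b B c (G t) $ i - x_ex A b B c (G u) $ i)
        * (s_ex A b B c (G t) $ i - s_ex A b B c (G u) $ i))" for t u
      by (rule exact_solves_monotone[OF solve solve])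
    show "Min (W t) < n" for t using Min[of t] W(1)[of t] by auto
    show "x_ex A b B c (G t) $ Min (W t) < 0" if "Min (W t) \<in> G t" for t
      using Min[of t] that by (auto simp: W_def free_viol_def bound_viol_def)
    show "s_ex A b B c (G t) $ Min (W t) < 0" if "Min (W t) \<notin> G t" for t
      using Min[of t] that by (auto simp: W_def free_viol_def bound_viol_def)
    show "0 \<le> x_ex A b B c (G t) $ i" if "i < Min (W t)" "i \<in> G t" for t i
      using below[OF that(1)] that(2) by (auto simp: W_def free_viol_def)
    show "0 \<le> s_ex A b B c (G t) $ i" if "i < Min (W t)" "i \<notin> G t" for t i
    proof -
      have "i < n" using that(1) Min[of t] W(1)[of t] by fastforce
      then show ?thesis using below[OF that(1)] that(2) by (auto simp: W_def bound_viol_def)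
    qed
    show "G (Suc t) = (if Min (W t) \<in> G t then G t - {Min (W t)} else G t \<union> {Min (W t)})" for t
      by (rule step)
  qed
qed

section \<open>Exact and inexact loop in lockstep\<close>

lemma sep_le:
  assumes "t \<le> T"
  shows "\<lbrakk>i \<in> Fs t; x_ex A b B c (Fs t) $ i \<noteq> 0\<rbrakk>
      \<Longrightarrow> sep A b B c T Fs \<le> ereal \<bar>x_ex A b B c (Fs t) $ i\<bar>"
    and "\<lbrakk>i < n; i \<notin> Fs t; s_ex A b B c (Fs t) $ i \<noteq> 0\<rbrakk>
      \<Longrightarrow> sep A b B c T Fs \<le> ereal \<bar>s_ex A b B c (Fs t) $ i\<bar>"
proof -
  let ?X = "{ereal \<bar>x_ex A b B c (Fs t) $ i\<bar> | i. i \<in> Fs t \<and> x_ex A b B c (Fs t) $ i \<noteq> 0}"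
  let ?S = "{ereal \<bar>s_ex A b B c (Fs t) $ i\<bar> | i.
    i < n \<and> i \<notin> Fs t \<and> s_ex A b B c (Fs t) $ i \<noteq> 0}"
  have le: "sep A b B c T Fs \<le> Inf (?X \<union> ?S)"
    unfolding sep_def dim_M by (rule INF_lower) (use assms in simp)
  have *: "sep A b B c T Fs \<le> r" if "r \<in> ?X \<union> ?S" for r
    using le Inf_lower[OF that] by (rule order_trans)
  show "sep A b B c T Fs \<le> ereal \<bar>x_ex A b B c (Fs t) $ i\<bar>"
    if "i \<in> Fs t" "x_ex A b B c (Fs t) $ i \<noteq> 0"
    by (rule *) (use that in blast)
  show "sep A b B c T Fs \<le> ereal \<bar>s_ex A b B c (Fs t) $ i\<bar>"
    if "i < n" "i \<notin> Fs t" "s_ex A b B c (Fs t) $ i \<noteq> 0"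
    by (rule *) (use that in blast)
qed

lemma inexact_step_eq_exact_step:
  assumes solve: "free_set_solve n p A B b c F"
    and adm: "admissible A B F v0 V1"
    and sep_x: "\<And>i. \<lbrakk>i \<in> F; x_ex A b B c F $ i \<noteq> 0\<rbrakk> \<Longrightarrow> \<mu> \<le> ereal \<bar>x_ex A b B c F $ i\<bar>"
    and sep_s: "\<And>i. \<lbrakk>i < n; i \<notin> F; s_ex A b B c F $ i \<noteq> 0\<rbrakk> \<Longrightarrow> \<mu> \<le> ereal \<bar>s_ex A b B c F $ i\<bar>"
    and small: "ereal (max (delta_x A b B c F v0 V1) (delta_s A b B c F v0 V1))
      < min (ereal eps) (\<mu> - ereal eps)"
  shows "loop_step n pmax eps (xfull n B c F v0 V1, redgrad A b B c F v0 V1) (F, N, q)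
    = loop_step n pmax 0 (x_ex A b B c F, s_ex A b B c F) (F, N, q)"
proof -
  interpret inexact_solve n p A B b c F v0 V1
    using solve adm by (simp add: inexact_solve_def inexact_solve_axioms_def)
  define d where "d = max (delta_x A b B c F v0 V1) (delta_s A b B c F v0 V1)"
  have d_eps: "d < eps" and d_\<mu>: "ereal d < \<mu> - ereal eps"
    using small by (simp_all add: d_def)
  have gap: "d < \<bar>r\<bar> - eps" if "\<mu> \<le> ereal \<bar>r\<bar>" for r
  proof -
    have "ereal d < ereal \<bar>r\<bar> - ereal eps"
      using d_\<mu> ereal_minus_mono[OF that order_refl] by (rule less_le_trans)
    then show ?thesis by simp
  qed
  have x: "xfull n B c F v0 V1 $ i < - eps \<longleftrightarrow> x_ex A b B c F $ i < - 0" if "i \<in> F" for i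
    using sign_test_stable[of "xfull n B c F v0 V1 $ i" "x_ex A b B c F $ i" d eps]
      xfull_error[OF that] d_eps gap sep_x[OF that] by (auto simp: d_def)
  have s: "redgrad A b B c F v0 V1 $ i < - eps \<longleftrightarrow> s_ex A b B c F $ i < - 0"
    if "i < n" "i \<notin> F" for i
    using sign_test_stable[of "redgrad A b B c F v0 V1 $ i" "s_ex A b B c F $ i" d eps]
      redgrad_error_delta_s[OF that] d_eps gap sep_s[OF that] by (auto simp: d_def)
  have "free_viol eps F (xfull n B c F v0 V1) = free_viol 0 F (x_ex A b B c F)"
    unfolding free_viol_def using x by blast
  moreover have "bound_viol n eps F (redgrad A b B c F v0 V1) = bound_viol n 0 F (s_ex A b B c F)"
    unfolding bound_viol_def using s by blast
  ultimately show ?thesis by (simp add: loop_step_def)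
qed

text \<open>While the exact loop runs, its free set is one of those that enter \<open>\<mu>\<close>, so that the accuracy
  assumption applies to a free set reached by both loops.\<close>

lemma inexact_loop_eq_exact_loop:
  assumes visits: "visits_exactly (exact_visit pmax A b B c) T Fs"
    and rank: "\<And>t F. exact_visit pmax A b B c t = Some F \<Longrightarrow> full_row_rank (csub B F)"
    and accurate: "\<And>t F. inexact_visit pmax eps A b B c v0s V1s t = Some F \<Longrightarrow>
      admissible A B F (v0s t) (V1s t) \<and>
      ereal (max (delta_x A b B c F (v0s t) (V1s t)) (delta_s A b B c F (v0s t) (V1s t)))
        < min (ereal eps) (sep A b B c T Fs - ereal eps)"
  shows "loop_at n pmax eps
      (\<lambda>t F. (xfull n B c F (v0s t) (V1s t), redgrad A b B c F (v0s t) (V1s t))) t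
    = loop_at n pmax 0 exact_solver t"
proof (induction t)
  case (Suc t)
  let ?inex = "\<lambda>t F. (xfull n B c F (v0s t) (V1s t), redgrad A b B c F (v0s t) (V1s t))"
  show ?case
  proof (cases "loop_at n pmax 0 exact_solver t")
    case None
    then show ?thesis using Suc.IH by simp
  next
    case (Some st)
    obtain F N q where st: "st = (F, N, q)" by (cases st)
    have vis: "exact_visit pmax A b B c t = Some F"
      using Some st by (simp add: exact_visit_def)
    have le: "t \<le> T"
    proof (rule ccontr)
      assume "\<not> t \<le> T"
      then show False using visits vis by (simp add: visits_exactly_def)
    qed
    moreover have "F = Fs t" using visits vis le by (simp add: visits_exactly_def)
    ultimately have t: "t \<le> T" "F = Fs t" .
    have "inexact_visit pmax eps A b B c v0s V1s t = Some F"
      using Some st Suc.IH by (simp add: inexact_visit_def)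
    note acc = accurate[OF this]
    have "F \<subseteq> {0..<n}" using Some st loop_at_subset by blast
    then have solve: "free_set_solve n p A B b c F"
      using rank[OF vis] by unfold_locales auto
    have "loop_step n pmax eps (?inex t F) (F, N, q)
        = loop_step n pmax 0 (exact_solver t F) (F, N, q)"
    proof (rule inexact_step_eq_exact_step[OF solve])
      show "sep A b B c T Fs \<le> ereal \<bar>x_ex A b B c F $ i\<bar>"
        if "i \<in> F" "x_ex A b B c F $ i \<noteq> 0" for i
        using sep_le(1)[OF t(1)] that unfolding t(2) .
      show "sep A b B c T Fs \<le> ereal \<bar>s_ex A b B c F $ i\<bar>"
        if "i < n" "i \<notin> F" "s_ex A b B c F $ i \<noteq> 0" for i
        using sep_le(2)[OF t(1)] that unfolding t(2) .
    qed (use acc in auto)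
    then show ?thesis using Some Suc.IH by (simp add: st)
  qed
qed simp

end

theorem corollary4p1:
  fixes n p :: nat and A B :: "real mat" and b c :: "real vec"
  assumes A: "sym_pos_def n A"
    and b: "b \<in> carrier_vec n"
    and B: "B \<in> carrier_mat p n" "full_row_rank B"
    and c: "c \<in> carrier_vec p"
  shows
    "(\<forall>F v0 V1. F \<subseteq> {0..<n} \<and> full_row_rank (csub B F) \<and> admissible A B F v0 V1 \<longrightarrow>
        delta_lam A b B c F v0 V1
          \<le> 2 * spectral_norm (csub B F) / (lam_min (S_ex A B F) * lam_min A)
              * (rho0 A b F v0 + rho1 A B F V1 * vnorm (lam_ex A b B c F)) \<and>
        delta_x A b B c F v0 V1
          \<le> (rho0 A b F v0 + rho1 A B F V1 * vnorm (lam_ex A b B c F)) / lam_min A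
              + (spectral_norm (csub B F) + rho1 A B F V1) / lam_min A * delta_lam A b B c F v0 V1 \<and>
        delta_s A b B c F v0 V1
          \<le> lam_max A * delta_x A b B c F v0 V1 + spectral_norm B * delta_lam A b B c F v0 V1)
     \<and>
     (\<forall>pmax. (\<forall>t F. exact_visit pmax A b B c t = Some F \<longrightarrow> full_row_rank (csub B F)) \<longrightarrow>
        (\<exists>T Fs. visits_exactly (exact_visit pmax A b B c) T Fs \<and>
           (\<forall>eps v0s V1s.
              0 < eps \<and> ereal eps < sep A b B c T Fs \<and>
              (\<forall>t F. inexact_visit pmax eps A b B c v0s V1s t = Some F \<longrightarrow>
                 admissible A B F (v0s t) (V1s t) \<and>
                 ereal (max (delta_x A b B c F (v0s t) (V1s t)) (delta_s A b B c F (v0s t) (V1s t)))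
                   < min (ereal eps) (sep A b B c T Fs - ereal eps)) \<longrightarrow>
              visits_exactly (inexact_visit pmax eps A b B c v0s V1s) T Fs) \<and>
           unique_minimiser A b B c (x_ex A b B c (Fs T))))"
proof (intro conjI allI impI, goal_cases)
  case (1 F v0 V1)
  then interpret inexact_solve n p A B b c F v0 V1
    using A b B c by unfold_locales auto
  show ?case by (rule multiplier_error_le)
next
  case (2 F v0 V1)
  then interpret inexact_solve n p A B b c F v0 V1
    using A b B c by unfold_locales auto
  show ?case by (rule x_error_le)
next
  case (3 F v0 V1)
  then interpret inexact_solve n p A B b c F v0 V1
    using A b B c by unfold_locales auto
  show ?case by (rule s_error_le)
next
  case (4 pmax)
  interpret eq_qp n p A B b c using A b B c by unfold_locales auto
  have rank: "\<And>t F. exact_visit pmax A b B c t = Some F \<Longrightarrow> full_row_rank (csub B F)"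
    using 4 by blast
  obtain t where "loop_at n pmax 0 exact_solver t = None"
    using exact_loop_terminates[of pmax] rank by auto
  then obtain T st where before: "\<forall>t\<le>T. loop_at n pmax 0 exact_solver t \<noteq> None"
    and after: "\<forall>t>T. loop_at n pmax 0 exact_solver t = None"
    and last: "loop_at n pmax 0 exact_solver T = Some st"
      "loop_step n pmax 0 (exact_solver T (fst st)) st = None"
    by (rule finite_loop_last_step)
  define Fs where "Fs = (\<lambda>t. the (exact_visit pmax A b B c t))"
  have visits: "visits_exactly (exact_visit pmax A b B c) T Fs"
    using before after by (auto simp: visits_exactly_def Fs_def exact_visit_def)
  obtain F N q where st: "st = (F, N, q)" by (cases st)
  have vis: "exact_visit pmax A b B c T = Some F"
    using last(1) st by (simp add: exact_visit_def)
  then have FT: "Fs T = F" by (simp add: Fs_def)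
  have sub: "F \<subseteq> {0..<n}" using last(1) st loop_at_subset by blast
  have solve: "free_set_solve n p A B b c F"
    using rank[OF vis] sub by unfold_locales auto
  have no_viol: "free_viol 0 F (x_ex A b B c F) = {}" "bound_viol n 0 F (s_ex A b B c F) = {}"
    using last(2) loop_step_None_iff[OF sub] by (simp_all add: st)
  have "0 \<le> x_ex A b B c F $ i" "0 \<le> s_ex A b B c F $ i" if "i < n" for i
    using no_viol that free_set_solve.s_ex_zero[OF solve, of i] free_set_solve.x_ex_zero[OF solve, of i]
    by (cases "i \<in> F"; force simp: free_viol_def bound_viol_def)+
  then have opt: "unique_minimiser A b B c (x_ex A b B c (Fs T))"
    unfolding FT by (rule exact_solve_unique_minimiser[OF solve])
  have "visits_exactly (inexact_visit pmax eps A b B c v0s V1s) T Fs"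
    if "\<forall>t F. inexact_visit pmax eps A b B c v0s V1s t = Some F \<longrightarrow>
         admissible A B F (v0s t) (V1s t) \<and>
         ereal (max (delta_x A b B c F (v0s t) (V1s t)) (delta_s A b B c F (v0s t) (V1s t)))
           < min (ereal eps) (sep A b B c T Fs - ereal eps)" for eps v0s V1s
  proof -
    have "inexact_visit pmax eps A b B c v0s V1s = exact_visit pmax A b B c"
      using inexact_loop_eq_exact_loop[OF visits, of eps v0s V1s] rank that
      by (auto simp: inexact_visit_def exact_visit_def)
    with visits show ?thesis by simp
  qed
  note lockstep = this
  show ?case
  proof (intro exI conjI allI impI)
    show "visits_exactly (exact_visit pmax A b B c) T Fs" by (rule visits)
    show "unique_minimiser A b B c (x_ex A b B c (Fs T))" by (rule opt)
  qed (elim conjE, rule lockstep)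
qed

end
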